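(* There is a number $\tilde t^*\approx 0.03727637$ such that: (1) For all $\tilde t<\tilde t^*$ (with $\tilde t\ge0$), there is a bipodal graphon with $b=1-a$ and $c=d=\frac12$ that is a local maximizer of the entropy among all bipodal graphons with edge density $\frac12$ and 2star density $\tilde t+\frac14$. (2) If $\tilde t^*<\tilde t\le 0.0625$, then there exist bipodal graphons with $b=1-a$ and $c=d=\frac12$ having edge density $\frac12$ and 2star density $\tilde t+\frac14$, but these graphons are not local maximizers of the entropy among all bipodal graphons with edge density $\frac12$ and 2star density $\tilde t+\frac14$. (3) If $\tilde t>0.0625$, then there do not exist bipodal graphons with $b=1-a$ and $c=d=\frac12$ having edge density $\frac12$ and 2star density $\tilde t+\frac14$.
   Context: A graphon is a symmetric measurable function $g:[0,1]^2\to[0,1]$. Its degree function is $d(x)=\int_0^1 g(x,y)\,dy$, its edge density is $e=\int_0^1\int_0^1 g(x,y)\,dx\,dy$, its 2star density is $t=\int_0^1 d(x)^2\,dx$, and its reduced 2star density is $\tilde t=t-e^2\ge 0$ (so $\tilde t=t-\frac14$ when $e=\frac12$). The entropy is $S(g)=\int_0^1\int_0^1 H(g(x,y))\,dx\,dy$ with $H(u)=-\frac12\left(u\ln u+(1-u)\ln(1-u)\right)$ (and $0\ln0=0$). A bipodal graphon with parameters $(a,b,c,d)\in[0,1]^4$ is the graphon with $g(x,y)=a$ if $x,y<c$, $g(x,y)=b$ if $x,y>c$, and $g(x,y)=d$ if $x<c<y$ or $y<c<x$. "Local maximizer among bipodal graphons" refers to the 4-dimensional space of parameters $(a,b,c,d)$,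 restricted to those with the given edge and 2star densities. *)

theory Defs
  imports "HOL-Analysis.Analysis"
begin

text \<open>Only the values of a graphon on the unit square are relevant.\<close>

definition graphon :: "(real \<Rightarrow> real \<Rightarrow> real) \<Rightarrow> bool" where
  "graphon g \<longleftrightarrow>
     set_borel_measurable lebesgue ({0..1} \<times> {0..1}) (\<lambda>(x, y). g x y) \<and>
     (\<forall>x\<in>{0..1}. \<forall>y\<in>{0..1}. g x y = g y x \<and> 0 \<le> g x y \<and> g x y \<le> 1)"

definition degree_fun :: "(real \<Rightarrow> real \<Rightarrow> real) \<Rightarrow> real \<Rightarrow> real" where
  "degree_fun g x = (LINT y:{0..1}|lebesgue. g x y)"

definition edge_density :: "(real \<Rightarrow> real \<Rightarrow> real) \<Rightarrow> real" where
  "edge_density g = (LINT x:{0..1}|lebesgue. (LINT y:{0..1}|lebesgue. g x y))"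

definition two_star_density :: "(real \<Rightarrow> real \<Rightarrow> real) \<Rightarrow> real" where
  "two_star_density g = (LINT x:{0..1}|lebesgue. (degree_fun g x)\<^sup>2)"

text \<open>The convention \<open>0 ln 0 = 0\<close> holds automatically, since \<open>0 * z = 0\<close> for every \<open>z\<close>.\<close>

definition entropy_density :: "real \<Rightarrow> real" where
  "entropy_density u = - (1/2) * (u * ln u + (1 - u) * ln (1 - u))"

definition graphon_entropy :: "(real \<Rightarrow> real \<Rightarrow> real) \<Rightarrow> real" where
  "graphon_entropy g =
     (LINT x:{0..1}|lebesgue. (LINT y:{0..1}|lebesgue. entropy_density (g x y)))"

text \<open>The values on the null set where \<open>x = c\<close> or \<open>y = c\<close> are immaterial; here the point \<open>c\<close> is
  put into the upper part.\<close>

fun bipodal :: "real \<times> real \<times> real \<times> real \<Rightarrow> real \<Rightarrow> real \<Rightarrow> real" where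
  "bipodal (a, b, c, d) x y =
     (if x < c \<and> y < c then a else if c \<le> x \<and> c \<le> y then b else d)"

lemma graphon_bipodal:
  assumes "a \<in> {0..1}" "b \<in> {0..1}" "d \<in> {0..1}"
  shows "graphon (bipodal (a, b, c, d))"
proof -
  have "(\<lambda>p. bipodal (a, b, c, d) (fst p) (snd p)) \<in> borel_measurable (borel \<Otimes>\<^sub>M borel)"
    unfolding bipodal.simps by measurable
  hence "(\<lambda>p. bipodal (a, b, c, d) (fst p) (snd p)) \<in> borel_measurable borel"
    by (simp only: borel_prod)
  hence "(\<lambda>(x, y). bipodal (a, b, c, d) x y) \<in> borel_measurable lebesgue"
    by (simp add: case_prod_unfold measurable_completion)
  moreover have "{0..1::real} \<times> {0..1::real} \<in> sets lebesgue"
    by (intro lmeasurable_compact[THEN fmeasurableD] compact_Times) auto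
  ultimately show ?thesis
    using assms by (auto simp: graphon_def set_borel_measurable_def)
qed

text \<open>The parameters in \<open>[0,1]\<^sup>4\<close> of the bipodal graphons with prescribed densities.\<close>

definition bipodal_params :: "real \<Rightarrow> real \<Rightarrow> (real \<times> real \<times> real \<times> real) set" where
  "bipodal_params e t =
     {p \<in> {0..1} \<times> {0..1} \<times> {0..1} \<times> {0..1}.
        edge_density (bipodal p) = e \<and> two_star_density (bipodal p) = t}"

text \<open>Local maximality is with respect to the topology of the four-dimensional parameter space.\<close>

definition bipodal_local_maximizer ::
  "real \<Rightarrow> real \<Rightarrow> real \<times> real \<times> real \<times> real \<Rightarrow> bool" where
  "bipodal_local_maximizer e t p \<longleftrightarrow>
     p \<in> bipodal_params e t \<and>
     (\<exists>\<epsilon>>0. \<forall>q\<in>bipodal_params e t. dist q p < \<epsilon> \<longrightarrow>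
        graphon_entropy (bipodal q) \<le> graphon_entropy (bipodal p))"

end

theory Submission
  imports Defs
begin

text \<open>A bipodal graphon with edge density \<open>1/2\<close> is best described by the
  deviations \<open>A = a - 1/2\<close>, \<open>B = 1/2 - b\<close>, \<open>y = d - 1/2\<close> and by the difference \<open>\<delta>\<close> of its two degrees. The
  edge density fixes \<open>c A = (1 - c) (\<delta> - y)\<close> and \<open>(1 - c) B = c (\<delta> + y)\<close>, and the reduced 2star density
  is \<open>c (1 - c) \<delta>\<^sup>2\<close> (\<open>bipodal_centred_coordinates\<close>, \<open>bipodal_centred_densities\<close>). So for \<open>\<alpha> \<noteq> 0\<close>, near
  a symmetric point \<open>(1/2 + \<alpha>, 1/2 - \<alpha>, 1/2, 1/2)\<close>, of reduced 2star density \<open>\<alpha>\<^sup>2/4\<close>, the constraint set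
  is a surface with coordinates \<open>w = 2 c - 1\<close> and \<open>y\<close>, and \<open>\<delta> = \<alpha> / sqrt (1 - w\<^sup>2)\<close>. In particular
  \<open>\<bar>\<alpha>\<bar> \<le> 1/2\<close> limits the reduced 2star density of symmetric points to \<open>1/16\<close>.

  With \<open>h s = H (1/2 + s)\<close> the entropy is \<open>c\<^sup>2 h A + (1 - c)\<^sup>2 h B + 2 c (1 - c) h y\<close>. Expand \<open>h\<close> at \<open>\<alpha>\<close>
  and at \<open>0\<close>. The linear terms add up to a multiple of \<open>w\<^sup>2\<close> in which \<open>y\<close> does not occur
  (\<open>linear_shift\<close>), and the quadratic terms of the two diagonal blocks add up to a multiple of
  \<open>(y + w (\<delta> + \<alpha>))\<^sup>2\<close> up to fourth order (\<open>quadratic_shift\<close>). For given \<open>w\<close> the best choice of \<open>y\<close> leaves the gain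
  \<open>w\<^sup>2 F(\<alpha>) / 4 + o(w\<^sup>2)\<close>, where \<open>F(\<alpha>) = 2 (h \<alpha> - h 0) - 3 \<alpha> h'(\<alpha>) - 4 \<alpha>\<^sup>2 / (1 - 2 \<alpha>\<^sup>2)\<close>.
  If \<open>F(\<alpha>) < 0\<close> the symmetric point is a local maximizer (\<open>local_maximizer_if_curvature_neg\<close>); if
  \<open>F(\<alpha>) > 0\<close> it is beaten along the curve \<open>y = - \<mu> w\<close> with the optimal slope \<open>\<mu> = \<alpha> / (1 - 2 \<alpha>\<^sup>2)\<close>
  (\<open>not_local_maximizer_if_curvature_pos\<close>). At the end point \<open>\<bar>\<alpha>\<bar> = 1/2\<close>, where \<open>h\<close> has infinite slope,
  moving away from the values \<open>0\<close> and \<open>1\<close> already gains more than any multiple of \<open>w\<^sup>2\<close>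
  (\<open>not_local_maximizer_half\<close>). The constant graphon, where \<open>\<alpha> = 0\<close>, maximizes the entropy outright.

  It remains to locate the sign change of \<open>F\<close>. In the variable \<open>z = 4 \<alpha>\<^sup>2\<close>, which is 16 times the
  reduced 2star density, \<open>F / z\<^sup>2\<close> is a power series whose constant term is negative and whose other
  coefficients are all positive (\<open>tilt_curvature_sums\<close>, \<open>curvature_coeff_pos\<close>). Hence it increases
  strictly and has at most one zero; partial sums with a geometric bound on the tail enclose that zero
  between two rational numbers (\<open>tilt_curvature_root\<close>).\<close>

section \<open>Densities and entropy of bipodal graphons\<close>

lemma set_integral_step:
  fixes c p q :: real
  assumes "0 \<le> c" "c \<le> 1"
  shows "(LINT x:{0..1}|lebesgue. if x < c then p else q) = c * p + (1 - c) * q"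
proof -
  have "(LINT x:{0..1}|lebesgue. if x < c then p else q)
      = (LINT x|lebesgue. p * indicator {0..<c} x + q * indicator {c..1} x)"
    unfolding set_lebesgue_integral_def using assms
    by (intro Bochner_Integration.integral_cong) (auto split: split_indicator)
  also have "\<dots> = c * p + (1 - c) * q"
    using assms by (subst Bochner_Integration.integral_add) auto
  finally show ?thesis .
qed

lemma degree_fun_bipodal:
  assumes "0 \<le> c" "c \<le> 1"
  shows "degree_fun (bipodal (a, b, c, d)) x =
    (if x < c then c * a + (1 - c) * d else c * d + (1 - c) * b)"
proof -
  have "bipodal (a, b, c, d) x = (\<lambda>y. if y < c then (if x < c then a else d) else (if x < c then d else b))"
    by auto
  thus ?thesis
    unfolding degree_fun_def by (simp add: set_integral_step[OF assms])
qed

lemma edge_density_bipodal: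
  assumes "0 \<le> c" "c \<le> 1"
  shows "edge_density (bipodal (a, b, c, d)) = c\<^sup>2 * a + (1 - c)\<^sup>2 * b + 2 * c * (1 - c) * d"
proof -
  have "edge_density (bipodal (a, b, c, d)) = (LINT x:{0..1}|lebesgue. degree_fun (bipodal (a, b, c, d)) x)"
    by (simp add: edge_density_def degree_fun_def)
  also have "\<dots> = c\<^sup>2 * a + (1 - c)\<^sup>2 * b + 2 * c * (1 - c) * d"
    unfolding degree_fun_bipodal[OF assms] set_integral_step[OF assms]
    by (simp add: algebra_simps power2_eq_square)
  finally show ?thesis .
qed

lemma two_star_density_bipodal:
  assumes "0 \<le> c" "c \<le> 1"
  shows "two_star_density (bipodal (a, b, c, d)) =
    c * (c * a + (1 - c) * d)\<^sup>2 + (1 - c) * (c * d + (1 - c) * b)\<^sup>2"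
  unfolding two_star_density_def degree_fun_bipodal[OF assms] if_distrib[where f = "\<lambda>u. u\<^sup>2"]
  by (rule set_integral_step[OF assms])

text \<open>Applying the entropy density to a bipodal kernel yields another bipodal kernel, so the entropy is
  an instance of the edge density.\<close>

lemma graphon_entropy_bipodal:
  assumes "0 \<le> c" "c \<le> 1"
  shows "graphon_entropy (bipodal (a, b, c, d)) =
    c\<^sup>2 * entropy_density a + (1 - c)\<^sup>2 * entropy_density b + 2 * c * (1 - c) * entropy_density d"
proof -
  let ?H = entropy_density
  have "(\<lambda>x y. ?H (bipodal (a, b, c, d) x y)) = bipodal (?H a, ?H b, c, ?H d)"
    by (auto simp: fun_eq_iff)
  hence "graphon_entropy (bipodal (a, b, c, d)) = edge_density (bipodal (?H a, ?H b, c, ?H d))"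
    unfolding graphon_entropy_def edge_density_def by (metis (no_types, lifting))
  thus ?thesis by (simp add: edge_density_bipodal[OF assms])
qed

section \<open>The entropy density around one half\<close>

definition centred_entropy :: "real \<Rightarrow> real" where
  "centred_entropy s = entropy_density (1/2 + s)"

text \<open>The derivative of \<open>centred_entropy\<close> on the open interval from \<open>- 1/2\<close> to \<open>1/2\<close>.\<close>

definition entropy_slope :: "real \<Rightarrow> real" where
  "entropy_slope s = (ln (1/2 - s) - ln (1/2 + s)) / 2"

lemma centred_entropy_minus [simp]: "centred_entropy (- s) = centred_entropy s"
  by (simp add: centred_entropy_def entropy_density_def)

lemma DERIV_centred_entropy:
  assumes "\<bar>s\<bar> < 1/2"
  shows "(centred_entropy has_real_derivative entropy_slope s) (at s)"
proof -
  have pos: "1/2 + s > 0" "1/2 - s > 0" using assms by (auto simp: abs_less_iff)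
  have xlnx: "((\<lambda>u. u * ln u) has_real_derivative ln u + 1) (at u)" if "u > 0" for u :: real
    using that by (auto intro!: derivative_eq_intros)
  have "((\<lambda>s. (1/2 + s) * ln (1/2 + s)) has_real_derivative (ln (1/2 + s) + 1) * 1) (at s)"
    using pos by (intro DERIV_chain2[OF xlnx]) (auto intro!: derivative_eq_intros)
  moreover have "((\<lambda>s. (1/2 - s) * ln (1/2 - s)) has_real_derivative (ln (1/2 - s) + 1) * - 1) (at s)"
    using pos by (intro DERIV_chain2[OF xlnx]) (auto intro!: derivative_eq_intros)
  ultimately have "((\<lambda>s. - (1/2) * ((1/2 + s) * ln (1/2 + s) + (1/2 - s) * ln (1/2 - s)))
      has_real_derivative - (1/2) * ((ln (1/2 + s) + 1) * 1 + (ln (1/2 - s) + 1) * - 1)) (at s)"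
    by (intro DERIV_cmult DERIV_add)
  moreover have "- (1/2) * ((ln (1/2 + s) + 1) * 1 + (ln (1/2 - s) + 1) * - 1) = entropy_slope s"
    by (simp add: entropy_slope_def) argo
  moreover have "centred_entropy = (\<lambda>s. - (1/2) * ((1/2 + s) * ln (1/2 + s) + (1/2 - s) * ln (1/2 - s)))"
    by (simp add: centred_entropy_def entropy_density_def fun_eq_iff)
  ultimately show ?thesis by (simp only:)
qed

lemma DERIV_entropy_slope:
  assumes "\<bar>s\<bar> < 1/2"
  shows "(entropy_slope has_real_derivative - 2 / (1 - 4 * s\<^sup>2)) (at s)"
proof -
  have "1 - 4 * s\<^sup>2 = 4 * ((1/2 - s) * (1/2 + s))" by (simp add: algebra_simps power2_eq_square)
  moreover have "1/2 - s > 0" "1/2 + s > 0" using assms by (auto simp: abs_less_iff)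
  ultimately show ?thesis
    unfolding entropy_slope_def[abs_def]
    by (auto intro!: derivative_eq_intros) (simp add: field_simps)
qed

text \<open>The second derivative of the centred entropy at \<open>\<xi>\<close> is \<open>- 2 / (1 - 4 \<xi>\<^sup>2)\<close>, whose size grows with
  \<open>\<bar>\<xi>\<bar>\<close>. Bounding \<open>\<xi>\<close> from below or above therefore turns the Lagrange remainder into explicit quadratic
  upper and lower bounds, with constants as close to the optimal one as needed.\<close>

lemma centred_entropy_Taylor:
  assumes "\<bar>r\<bar> < 1/2" "\<bar>s\<bar> < 1/2"
  obtains \<xi> where "min r s \<le> \<xi>" "\<xi> \<le> max r s"
    "centred_entropy s = centred_entropy r + entropy_slope r * (s - r) - (s - r)\<^sup>2 / (1 - 4 * \<xi>\<^sup>2)"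
proof (cases "s = r")
  case True
  thus ?thesis using that[of r] by simp
next
  case False
  \<comment> \<open>The denominator is kept opaque so that rewriting does not distribute over it.\<close>
  define k where "k t = 1 - 4 * t\<^sup>2" for t :: real
  let ?diff = "\<lambda>m::nat. if m = 0 then centred_entropy else if m = 1 then entropy_slope
                 else (\<lambda>t. - 2 / k t)"
  have "\<exists>t. (if s < r then s < t \<and> t < r else r < t \<and> t < s) \<and>
    centred_entropy s = (\<Sum>m<2. (?diff m r / fact m) * (s - r)^m) + (?diff 2 t / fact 2) * (s - r)^2"
  proof (rule Taylor[of 2 ?diff _ "min r s" "max r s"])
    show "\<forall>m t. m < 2 \<and> min r s \<le> t \<and> t \<le> max r s \<longrightarrow> DERIV (?diff m) t :> ?diff (Suc m) t"
    proof (intro allI impI, elim conjE)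
      fix m :: nat and t :: real
      assume "m < 2" "min r s \<le> t" "t \<le> max r s"
      moreover from this have "\<bar>t\<bar> < 1/2" using assms by (auto simp: min_def max_def split: if_splits)
      ultimately show "DERIV (?diff m) t :> ?diff (Suc m) t"
        using DERIV_centred_entropy DERIV_entropy_slope by (auto simp: less_2_cases_iff k_def)
    qed
  qed (use False in auto)
  then obtain t where t: "if s < r then s < t \<and> t < r else r < t \<and> t < s"
    "centred_entropy s = centred_entropy r + entropy_slope r * (s - r) - (s - r)\<^sup>2 / k t"
    by (auto simp: numeral_2_eq_2)
  show ?thesis using t by (intro that[of t]) (auto simp: k_def split: if_splits)
qed

lemma centred_entropy_le_quadratic:
  assumes "0 \<le> \<rho>" "\<rho> \<le> r" "\<rho> \<le> s" "r < 1/2" "s < 1/2"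
  shows "centred_entropy s \<le> centred_entropy r + entropy_slope r * (s - r) - (s - r)\<^sup>2 / (1 - 4 * \<rho>\<^sup>2)"
proof -
  obtain \<xi> where \<xi>: "min r s \<le> \<xi>" "\<xi> \<le> max r s"
    "centred_entropy s = centred_entropy r + entropy_slope r * (s - r) - (s - r)\<^sup>2 / (1 - 4 * \<xi>\<^sup>2)"
    using centred_entropy_Taylor[of r s] assms by auto
  have "\<rho> \<le> \<xi>" "\<xi> < 1/2" using \<xi> assms by auto
  hence "\<rho>\<^sup>2 \<le> \<xi>\<^sup>2" "\<xi>\<^sup>2 < (1/2)\<^sup>2" using assms by (auto intro!: power_mono power_strict_mono)
  hence "(s - r)\<^sup>2 / (1 - 4 * \<rho>\<^sup>2) \<le> (s - r)\<^sup>2 / (1 - 4 * \<xi>\<^sup>2)"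
    by (intro divide_left_mono mult_pos_pos) (auto simp: power2_eq_square)
  thus ?thesis using \<xi> by simp
qed

lemma centred_entropy_ge_quadratic:
  assumes "\<bar>r\<bar> \<le> \<rho>" "\<bar>s\<bar> \<le> \<rho>" "\<rho> < 1/2"
  shows "centred_entropy r + entropy_slope r * (s - r) - (s - r)\<^sup>2 / (1 - 4 * \<rho>\<^sup>2) \<le> centred_entropy s"
proof -
  obtain \<xi> where \<xi>: "min r s \<le> \<xi>" "\<xi> \<le> max r s"
    "centred_entropy s = centred_entropy r + entropy_slope r * (s - r) - (s - r)\<^sup>2 / (1 - 4 * \<xi>\<^sup>2)"
    using centred_entropy_Taylor[of r s] assms by auto
  have "\<bar>\<xi>\<bar> \<le> \<bar>\<rho>\<bar>" using \<xi>(1,2) assms by (auto simp: min_def max_def split: if_splits)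
  hence "\<xi>\<^sup>2 \<le> \<rho>\<^sup>2" by (simp add: abs_le_square_iff)
  moreover have "\<rho>\<^sup>2 < (1/2)\<^sup>2" using assms by (intro power_strict_mono) auto
  ultimately have "(s - r)\<^sup>2 / (1 - 4 * \<xi>\<^sup>2) \<le> (s - r)\<^sup>2 / (1 - 4 * \<rho>\<^sup>2)"
    by (intro divide_left_mono mult_pos_pos) (auto simp: power2_eq_square)
  thus ?thesis using \<xi> by simp
qed

lemma entropy_slope_0 [simp]: "entropy_slope 0 = 0"
  by (simp add: entropy_slope_def)

lemma centred_entropy_le_cap:
  assumes "\<bar>s\<bar> < 1/2"
  shows "centred_entropy s \<le> centred_entropy 0 - s\<^sup>2"
  using centred_entropy_le_quadratic[of 0 0 "\<bar>s\<bar>"] assms by (cases "s \<ge> 0") auto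

lemma centred_entropy_half: "centred_entropy (1/2) = 0"
proof -
  have "1/2 + 1/2 = (1::real)" by simp
  thus ?thesis by (simp only: centred_entropy_def entropy_density_def) simp
qed

text \<open>The slope at the end point is infinite, so near it the entropy lies above every line through it.
  For \<open>v = 1/2 - s\<close> the term \<open>- v ln v / 2\<close> alone exceeds \<open>M v\<close> as soon as \<open>ln v \<le> - 2 M\<close>.\<close>

lemma centred_entropy_steep_at_half:
  assumes "0 \<le> M" "1/2 - exp (- 2 * M) \<le> s" "0 \<le> s" "s \<le> 1/2"
  shows "M * (1/2 - s) \<le> centred_entropy s"
proof (cases "s = 1/2")
  case True
  thus ?thesis by (simp only: centred_entropy_half) simp
next
  case False
  define v where "v = 1/2 - s"
  have v: "0 < v" "v \<le> exp (- 2 * M)" "v \<le> 1/2" using assms False by (auto simp: v_def)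
  hence "ln v \<le> ln (exp (- 2 * M))" by (subst ln_le_cancel_iff) auto
  hence "v * ln v \<le> v * (- 2 * M)" using v by (intro mult_left_mono) auto
  moreover have "(1 - v) * ln (1 - v) \<le> 0" using v by (intro mult_nonneg_nonpos) auto
  moreover have "centred_entropy s = - (1/2) * ((1 - v) * ln (1 - v) + v * ln v)"
    by (simp add: centred_entropy_def entropy_density_def v_def)
  ultimately show ?thesis by (simp add: v_def[symmetric] algebra_simps)
qed

section \<open>The curvature function and its power series\<close>

text \<open>Four times the coefficient of \<open>w\<^sup>2\<close> in the entropy gained by moving the cut point from \<open>1/2\<close> to
  \<open>(1 + w)/2\<close> and adjusting the off-diagonal value optimally. The entropy near the symmetric point is concave
  in the other direction, so the sign of this number is decisive for local maximality.\<close>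

definition tilt_curvature :: "real \<Rightarrow> real" where
  "tilt_curvature \<alpha> = 2 * (centred_entropy \<alpha> - centred_entropy 0) - 3 * \<alpha> * entropy_slope \<alpha>
     - 4 * \<alpha>\<^sup>2 / (1 - 2 * \<alpha>\<^sup>2)"

text \<open>The terms come from \<open>ln (1 - z)\<close>, from \<open>artanh\<close> and from the geometric series of
  \<open>2 z / (2 - z)\<close>.\<close>

definition curvature_coeff :: "nat \<Rightarrow> real" where
  "curvature_coeff n = 1 / (2 * real n) + 1 / (2 * (2 * real n - 1)) - 2 / 2 ^ n"

text \<open>In terms of \<open>\<beta> = 2 \<alpha>\<close> and \<open>z = \<beta>\<^sup>2\<close> the logarithms combine into \<open>ln (1 - z)\<close> and
  \<open>\<beta> artanh \<beta>\<close>, which are both power series in \<open>z\<close>.\<close>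

lemma tilt_curvature_closed_form:
  assumes "0 \<le> z" "z < 1"
  shows "tilt_curvature (sqrt z / 2) =
    - ln (1 - z) / 2 + sqrt z * (ln (1 + sqrt z) - ln (1 - sqrt z)) / 4 - 2 * z / (2 - z)"
proof -
  define \<beta> where "\<beta> = sqrt z"
  have \<beta>: "0 \<le> \<beta>" "\<beta> < 1" "\<beta>\<^sup>2 = z" using assms by (auto simp: \<beta>_def)
  have half: "1/2 + \<beta>/2 = (1 + \<beta>) / 2" "1 - (1/2 + \<beta>/2) = (1 - \<beta>) / 2" "1/2 - \<beta>/2 = (1 - \<beta>) / 2"
    by (simp_all add: field_simps)
  have ln_half: "ln ((1 + \<beta>) / 2) = ln (1 + \<beta>) - ln 2" "ln ((1 - \<beta>) / 2) = ln (1 - \<beta>) - ln 2"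
    "ln (1/2::real) = - ln 2"
    using \<beta> by (simp_all add: ln_div)
  have "1 - z = (1 + \<beta>) * (1 - \<beta>)" using \<beta> by (simp add: algebra_simps power2_eq_square)
  hence ln_z: "ln (1 - z) = ln (1 + \<beta>) + ln (1 - \<beta>)" using \<beta> by (simp add: ln_mult)
  have quot: "4 * (\<beta>/2)\<^sup>2 / (1 - 2 * (\<beta>/2)\<^sup>2) = 2 * z / (2 - z)"
    using assms by (simp add: power_divide \<beta>(3) field_simps)
  have entropy: "centred_entropy (\<beta>/2) - centred_entropy 0
      = - ((1 + \<beta>) * ln (1 + \<beta>) + (1 - \<beta>) * ln (1 - \<beta>)) / 4"
    unfolding centred_entropy_def entropy_density_def half ln_half
    by (simp add: ln_half algebra_simps) (simp add: ln_half field_simps)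
  have slope: "entropy_slope (\<beta>/2) = (ln (1 - \<beta>) - ln (1 + \<beta>)) / 2"
    unfolding entropy_slope_def half ln_half by simp
  show ?thesis
    unfolding tilt_curvature_def \<beta>_def[symmetric] quot ln_z entropy slope
    by (simp add: field_simps)
qed

text \<open>The coefficient of \<open>z\<close> vanishes, which is why \<open>z\<^sup>2\<close> can be divided out: to leading order a graphon
  close to the constant one neither gains nor loses by tilting.\<close>

lemma tilt_curvature_sums:
  assumes "0 < z" "z < 1"
  shows "(\<lambda>n. curvature_coeff (n + 2) * z ^ n) sums (tilt_curvature (sqrt z / 2) / z\<^sup>2)"
proof -
  define \<beta> where "\<beta> = sqrt z"
  have \<beta>: "0 < \<beta>" "\<beta> < 1" "\<beta>\<^sup>2 = z" using assms by (auto simp: \<beta>_def)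
  have S1: "(\<lambda>n. z ^ Suc n / (2 * real (Suc n))) sums (- ln (1 - z) / 2)"
  proof -
    have "(\<lambda>n. - (z ^ n) / real n) sums ln (1 - z)"
      using ln_series'[of "- z"] assms by simp
    hence "(\<lambda>n. - (z ^ Suc n) / real (Suc n)) sums ln (1 - z)"
      by (subst sums_Suc_iff) simp
    from sums_mult[OF this, of "- 1 / 2"] show ?thesis
      by (simp add: field_simps)
  qed
  have S2: "(\<lambda>n. z ^ Suc n / (2 * (2 * real (Suc n) - 1))) sums (\<beta> * (ln (1 + \<beta>) - ln (1 - \<beta>)) / 4)"
  proof -
    have "((1 + \<beta>) / (1 - \<beta>) - 1) / ((1 + \<beta>) / (1 - \<beta>) + 1) = \<beta>"
      using \<beta> by (simp add: divide_simps)
    hence "(\<lambda>n. 2 * \<beta> ^ (2 * n + 1) / of_nat (2 * n + 1)) sums (ln (1 + \<beta>) - ln (1 - \<beta>))"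
      using ln_series_quadratic[of "(1 + \<beta>) / (1 - \<beta>)"] \<beta> by (simp add: ln_div)
    note sums_quarter = sums_mult[OF this, of "\<beta> / 4"]
    have summand: "\<beta> / 4 * (2 * \<beta> ^ (2 * n + 1) / of_nat (2 * n + 1)) = z ^ Suc n / (2 * (2 * real (Suc n) - 1))" for n
    proof -
      have "\<beta> * \<beta> ^ (2 * n + 1) = z ^ Suc n"
        unfolding \<beta>(3)[symmetric] power_mult[symmetric] by simp
      moreover have "real (2 * n + 1) = 2 * real (Suc n) - 1" by simp
      moreover have "\<beta> / 4 * (2 * p / q) = \<beta> * p / (2 * q)" for p q by simp
      ultimately show ?thesis by (simp only:)
    qed
    show ?thesis using sums_quarter unfolding summand by simp
  qed
  have S3: "(\<lambda>n. 2 * z ^ Suc n / 2 ^ Suc n) sums (2 * z / (2 - z))"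
  proof -
    have "(\<lambda>n. (z/2) ^ n) sums (1 / (1 - z/2))" using assms by (intro geometric_sums) auto
    from sums_mult[OF this, of z] show ?thesis
      using assms by (simp add: field_simps power_divide)
  qed
  have "curvature_coeff (Suc n) * z ^ Suc n = z ^ Suc n / (2 * real (Suc n))
      + z ^ Suc n / (2 * (2 * real (Suc n) - 1)) - 2 * z ^ Suc n / 2 ^ Suc n" for n
    unfolding curvature_coeff_def by (simp only: ring_distribs) simp
  hence "(\<lambda>n. curvature_coeff (Suc n) * z ^ Suc n) sums tilt_curvature (sqrt z / 2)"
    using sums_diff[OF sums_add[OF S1 S2] S3] tilt_curvature_closed_form[of z] assms
    by (simp only: less_imp_le \<beta>_def[symmetric])
  moreover have "curvature_coeff (Suc 0) = 0" by (simp add: curvature_coeff_def)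
  ultimately have "(\<lambda>n. curvature_coeff (n + 2) * z ^ (n + 2)) sums tilt_curvature (sqrt z / 2)"
    using sums_Suc_iff[of "\<lambda>n. curvature_coeff (Suc n) * z ^ Suc n" "tilt_curvature (sqrt z / 2)"]
    by simp
  from sums_divide[OF this, of "z\<^sup>2"] show ?thesis
    using assms unfolding power_add by simp
qed

text \<open>Only the geometric term is negative, and from index 3 on the two harmonic terms together dominate it. The
  coefficient of index 2 is \<open>- 1/12\<close>.\<close>

lemma curvature_coeff_pos:
  assumes "n \<ge> 3"
  shows "curvature_coeff n > 0"
proof (cases "n = 3")
  case True
  thus ?thesis by (simp add: curvature_coeff_def)
next
  case False
  have "4 * real n \<le> 2 ^ n" if "n \<ge> 4" for n
    using that by (induction n rule: dec_induct) (auto simp: eval_nat_numeral)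
  hence "4 * real n \<le> 2 ^ n" using assms False by auto
  hence "2 / 2 ^ n \<le> 2 / (4 * real n)" using assms by (intro divide_left_mono) auto
  moreover have "1 / (2 * (2 * real n - 1)) > 0" using assms by simp
  moreover have "2 / (4 * real n) = 1 / (2 * real n)" by simp
  ultimately show ?thesis unfolding curvature_coeff_def by linarith
qed

lemma curvature_coeff_le:
  assumes "0 < N" "N \<le> n"
  shows "curvature_coeff n \<le> 1 / real N"
proof -
  have "1 / (2 * real n) \<le> 1 / (2 * real N)" "1 / (2 * (2 * real n - 1)) \<le> 1 / (2 * real N)"
    using assms by (auto intro!: divide_left_mono)
  moreover have "2 / 2 ^ n \<ge> (0::real)" by simp
  moreover have "1 / (2 * real N) + 1 / (2 * real N) = 1 / real N" by simp
  ultimately show ?thesis unfolding curvature_coeff_def by linarith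
qed

lemma tilt_curvature_strict_mono:
  assumes "0 < z" "z < z'" "z' < 1"
  shows "tilt_curvature (sqrt z / 2) / z\<^sup>2 < tilt_curvature (sqrt z' / 2) / z'\<^sup>2"
proof -
  let ?D = "\<lambda>n. curvature_coeff (n + 2) * z' ^ n - curvature_coeff (n + 2) * z ^ n"
  have sums: "?D sums (tilt_curvature (sqrt z' / 2) / z'\<^sup>2 - tilt_curvature (sqrt z / 2) / z\<^sup>2)"
    using assms by (intro sums_diff tilt_curvature_sums) auto
  have "?D n \<ge> 0" for n
  proof (cases "n = 0")
    case False
    thus ?thesis using assms curvature_coeff_pos[of "n + 2"]
      by (auto intro!: mult_left_mono power_mono)
  qed simp
  moreover have "?D 1 > 0"
  proof -
    have "1 + 2 = (3::nat)" by simp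
    thus ?thesis using assms curvature_coeff_pos[of 3] by (simp only: power_one_right) simp
  qed
  ultimately have "0 < suminf ?D"
    using sums_summable[OF sums] by (intro suminf_pos2[of _ 1]) auto
  thus ?thesis using sums_unique[OF sums] by simp
qed

section \<open>Numerical enclosure of the critical value\<close>

text \<open>Horner's scheme keeps the intermediate fractions small enough for exact evaluation by rewriting.\<close>

lemma horner_eq_sum:
  fixes f :: "nat \<Rightarrow> 'a :: comm_semiring_1"
  shows "foldr (\<lambda>n s. f n + z * s) [m..<m + k] 0 = (\<Sum>n<k. f (n + m) * z ^ n)"
proof (induction k arbitrary: m)
  case (Suc k)
  have "foldr (\<lambda>n s. f n + z * s) [m..<m + Suc k] 0 = f m + z * foldr (\<lambda>n s. f n + z * s) [Suc m..<Suc m + k] 0"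
    by (subst upt_conv_Cons) simp_all
  also have "\<dots> = (\<Sum>n<Suc k. f (n + m) * z ^ n)"
    unfolding Suc.IH by (simp add: sum.lessThan_Suc_shift sum_distrib_left mult_ac del: sum.lessThan_Suc)
  finally show ?case .
qed simp

lemma tilt_curvature_ge_partial:
  assumes "0 < z" "z < 1" "k > 0"
  shows "(\<Sum>n<k. curvature_coeff (n + 2) * z ^ n) \<le> tilt_curvature (sqrt z / 2) / z\<^sup>2"
proof -
  note s = tilt_curvature_sums[OF assms(1,2)]
  have "0 \<le> curvature_coeff (n + 2) * z ^ n" if "n \<in> - {..<k}" for n
    using that assms by (intro mult_nonneg_nonneg less_imp_le[OF curvature_coeff_pos]) auto
  hence "(\<Sum>n<k. curvature_coeff (n + 2) * z ^ n) \<le> (\<Sum>n. curvature_coeff (n + 2) * z ^ n)"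
    by (intro sum_le_suminf sums_summable[OF s]) auto
  thus ?thesis unfolding sums_unique[OF s, symmetric] .
qed

lemma tilt_curvature_le_partial:
  assumes "0 < z" "z < 1"
  shows "tilt_curvature (sqrt z / 2) / z\<^sup>2
    \<le> (\<Sum>n<k. curvature_coeff (n + 2) * z ^ n) + z ^ k / (real (k + 2) * (1 - z))"
proof -
  let ?f = "\<lambda>n. curvature_coeff (n + 2) * z ^ n"
  have "(\<lambda>n. ?f (n + k)) sums (tilt_curvature (sqrt z / 2) / z\<^sup>2 - (\<Sum>n<k. ?f n))"
    by (rule sums_split_initial_segment[OF tilt_curvature_sums[OF assms]])
  moreover have "(\<lambda>n. z ^ k / real (k + 2) * z ^ n) sums (z ^ k / real (k + 2) * (1 / (1 - z)))"
    using assms by (intro sums_mult geometric_sums) auto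
  moreover have "?f (n + k) \<le> z ^ k / real (k + 2) * z ^ n" for n
  proof -
    have "?f (n + k) \<le> 1 / real (k + 2) * z ^ (n + k)"
      using assms by (intro mult_right_mono curvature_coeff_le) auto
    also have "\<dots> = z ^ k / real (k + 2) * z ^ n"
      unfolding power_add by simp
    finally show ?thesis .
  qed
  ultimately have "tilt_curvature (sqrt z / 2) / z\<^sup>2 - (\<Sum>n<k. ?f n) \<le> z ^ k / real (k + 2) * (1 / (1 - z))"
    by (rule sums_le[rotated])
  thus ?thesis by simp
qed

text \<open>The two evaluation points are \<open>16 \<cdot> 0.037276375\<close> and \<open>16 \<cdot> 0.037276365\<close>. With 33 terms the tail
  is below \<open>3 \<cdot> 10\<^sup>-\<^sup>9\<close>, while the partial sums are about \<open>3 \<cdot> 10\<^sup>-\<^sup>8\<close> and \<open>- 4 \<cdot> 10\<^sup>-\<^sup>8\<close>.\<close>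

lemma tilt_curvature_pos_numeric: "0 < tilt_curvature (sqrt (298211/500000) / 2)"
proof -
  have "0 < foldr (\<lambda>n s. curvature_coeff n + (298211/500000) * s) [2..<2 + 33] 0"
    unfolding curvature_coeff_def by (simp add: upt_rec_numeral)
  also have "\<dots> \<le> tilt_curvature (sqrt (298211/500000) / 2) / (298211/500000)\<^sup>2"
    unfolding horner_eq_sum by (intro tilt_curvature_ge_partial) auto
  finally show ?thesis by (simp only: zero_less_divide_iff) simp
qed

lemma tilt_curvature_neg_numeric: "tilt_curvature (sqrt (7455273/12500000) / 2) < 0"
proof -
  let ?z = "7455273/12500000 :: real"
  have "foldr (\<lambda>n s. curvature_coeff n + ?z * s) [2..<2 + 33] 0 < - 1 / 10 ^ 8"
    unfolding curvature_coeff_def by (simp add: upt_rec_numeral)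
  moreover have "?z ^ 33 / (real (33 + 2) * (1 - ?z)) < 1 / 10 ^ 8"
    by (simp add: power_divide)
  ultimately have "foldr (\<lambda>n s. curvature_coeff n + ?z * s) [2..<2 + 33] 0
      + ?z ^ 33 / (real (33 + 2) * (1 - ?z)) < - 1 / 10 ^ 8 + 1 / 10 ^ 8"
    by (rule add_strict_mono)
  also have "- 1 / 10 ^ 8 + 1 / 10 ^ 8 = (0 :: real)" by simp
  finally have "foldr (\<lambda>n s. curvature_coeff n + ?z * s) [2..<2 + 33] 0
      + ?z ^ 33 / (real (33 + 2) * (1 - ?z)) < 0" .
  moreover have "tilt_curvature (sqrt ?z / 2) / ?z\<^sup>2 \<le> foldr (\<lambda>n s. curvature_coeff n + ?z * s) [2..<2 + 33] 0
      + ?z ^ 33 / (real (33 + 2) * (1 - ?z))"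
    unfolding horner_eq_sum by (intro tilt_curvature_le_partial) auto
  ultimately have "tilt_curvature (sqrt ?z / 2) / ?z\<^sup>2 < 0"
    by (rule order.strict_trans1[rotated])
  thus ?thesis by (simp only: divide_less_0_iff) simp
qed

text \<open>Existence of the zero is the intermediate value theorem for the closed form; strict monotonicity of
  the series gives the signs on both sides.\<close>

lemma tilt_curvature_root:
  obtains z\<^sub>0 where "7455273/12500000 \<le> z\<^sub>0" "z\<^sub>0 \<le> 298211/500000"
    "\<And>z. 0 < z \<Longrightarrow> z < z\<^sub>0 \<Longrightarrow> tilt_curvature (sqrt z / 2) < 0"
    "\<And>z. z\<^sub>0 < z \<Longrightarrow> z < 1 \<Longrightarrow> 0 < tilt_curvature (sqrt z / 2)"
proof -
  let ?F = "\<lambda>z. - ln (1 - z) / 2 + sqrt z * (ln (1 + sqrt z) - ln (1 - sqrt z)) / 4 - 2 * z / (2 - z)"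
  let ?a = "7455273/12500000 :: real" and ?b = "298211/500000 :: real"
  have "\<exists>z\<ge>?a. z \<le> ?b \<and> ?F z = 0"
  proof (rule IVT')
    show "?F ?a \<le> 0" "0 \<le> ?F ?b"
      using tilt_curvature_pos_numeric tilt_curvature_neg_numeric tilt_curvature_closed_form[of ?a] tilt_curvature_closed_form[of ?b]
      by simp_all
    have "1 - z \<noteq> 0" "1 - sqrt z \<noteq> 0" "1 + sqrt z \<noteq> 0" "2 - z \<noteq> 0" if "z \<in> {?a..?b}" for z
    proof -
      have z: "0 < z" "z < 1" using that by auto
      hence "sqrt z < 1" "sqrt z > 0" by simp_all
      with z show "1 - z \<noteq> 0" "1 - sqrt z \<noteq> 0" "1 + sqrt z \<noteq> 0" "2 - z \<noteq> 0" by linarith+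
    qed
    thus "continuous_on {?a..?b} ?F" by (intro continuous_intros) auto
  qed simp
  then obtain z\<^sub>0 where z: "?a \<le> z\<^sub>0" "z\<^sub>0 \<le> ?b" "?F z\<^sub>0 = 0" by auto
  hence z0: "0 < z\<^sub>0" "z\<^sub>0 < 1" "tilt_curvature (sqrt z\<^sub>0 / 2) = 0"
    using tilt_curvature_closed_form[of z\<^sub>0] by auto
  show ?thesis
  proof (rule that[OF z(1,2)])
    show "tilt_curvature (sqrt z / 2) < 0" if "0 < z" "z < z\<^sub>0" for z
      using tilt_curvature_strict_mono[of z z\<^sub>0] that z0 by (simp add: divide_less_0_iff)
    show "0 < tilt_curvature (sqrt z / 2)" if "z\<^sub>0 < z" "z < 1" for z
      using tilt_curvature_strict_mono[of z\<^sub>0 z] that z0 by (simp add: zero_less_divide_iff)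
  qed
qed

section \<open>The constraint surface near a symmetric point\<close>

text \<open>The two degrees are \<open>1/2 + \<sigma> (1 - c) \<delta>\<close> and \<open>1/2 - \<sigma> c \<delta>\<close>, whose mean is \<open>1/2\<close> and whose variance
  is \<open>c (1 - c) \<delta>\<^sup>2\<close>. The sign \<open>\<sigma>\<close> treats a graphon and its complement at once.\<close>

lemma bipodal_centred_densities:
  fixes \<sigma> :: real
  assumes c: "0 \<le> c" "c \<le> 1" and sign: "\<sigma>\<^sup>2 = 1"
    and A: "c * A = (1 - c) * (\<delta> - y)" and B: "(1 - c) * B = c * (\<delta> + y)"
  shows "edge_density (bipodal (1/2 + \<sigma> * A, 1/2 - \<sigma> * B, c, 1/2 + \<sigma> * y)) = 1/2"
    and "two_star_density (bipodal (1/2 + \<sigma> * A, 1/2 - \<sigma> * B, c, 1/2 + \<sigma> * y))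
      = c * (1 - c) * \<delta>\<^sup>2 + 1/4"
proof -
  have upper: "c * (1/2 + \<sigma> * A) + (1 - c) * (1/2 + \<sigma> * y) = 1/2 + \<sigma> * (1 - c) * \<delta>"
  proof -
    have "c * (1/2 + \<sigma> * A) + (1 - c) * (1/2 + \<sigma> * y) = 1/2 + \<sigma> * (c * A + (1 - c) * y)"
      by (simp add: field_simps)
    thus ?thesis unfolding A by (simp add: field_simps)
  qed
  have lower: "c * (1/2 + \<sigma> * y) + (1 - c) * (1/2 - \<sigma> * B) = 1/2 - \<sigma> * c * \<delta>"
  proof -
    have "c * (1/2 + \<sigma> * y) + (1 - c) * (1/2 - \<sigma> * B) = 1/2 + \<sigma> * (c * y - (1 - c) * B)"
      by (simp add: field_simps)
    thus ?thesis unfolding B by (simp add: field_simps)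
  qed
  have "c\<^sup>2 * (1/2 + \<sigma> * A) + (1 - c)\<^sup>2 * (1/2 - \<sigma> * B) + 2 * c * (1 - c) * (1/2 + \<sigma> * y)
      = c * (c * (1/2 + \<sigma> * A) + (1 - c) * (1/2 + \<sigma> * y))
        + (1 - c) * (c * (1/2 + \<sigma> * y) + (1 - c) * (1/2 - \<sigma> * B))"
    by (simp add: field_simps power2_eq_square)
  thus "edge_density (bipodal (1/2 + \<sigma> * A, 1/2 - \<sigma> * B, c, 1/2 + \<sigma> * y)) = 1/2"
    unfolding edge_density_bipodal[OF c] upper lower by (simp add: field_simps)
  have "c * (1/2 + \<sigma> * (1 - c) * \<delta>)\<^sup>2 + (1 - c) * (1/2 - \<sigma> * c * \<delta>)\<^sup>2
      = \<sigma>\<^sup>2 * (c * (1 - c) * \<delta>\<^sup>2) + 1/4"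
    by (simp add: field_simps power2_eq_square)
  thus "two_star_density (bipodal (1/2 + \<sigma> * A, 1/2 - \<sigma> * B, c, 1/2 + \<sigma> * y)) = c * (1 - c) * \<delta>\<^sup>2 + 1/4"
    unfolding two_star_density_bipodal[OF c] upper lower sign by simp
qed

text \<open>Conversely, every bipodal graphon of edge density one half with two nonempty blocks has this form.\<close>

lemma bipodal_centred_coordinates:
  assumes c: "0 < c" "c < 1"
    and e: "edge_density (bipodal (a, b, c, d)) = 1/2"
  obtains \<delta> where "c * (a - 1/2) = (1 - c) * (\<delta> - (d - 1/2))"
    "(1 - c) * (1/2 - b) = c * (\<delta> + (d - 1/2))"
    "two_star_density (bipodal (a, b, c, d)) = c * (1 - c) * \<delta>\<^sup>2 + 1/4"
proof -
  define A B y where "A = a - 1/2" and "B = 1/2 - b" and "y = d - 1/2"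
  define \<delta> where "\<delta> = c * A + (1 - c) * B + (1 - 2 * c) * y"
  have e0: "c\<^sup>2 * A - (1 - c)\<^sup>2 * B + 2 * c * (1 - c) * y = 0"
  proof -
    have "c\<^sup>2 * A - (1 - c)\<^sup>2 * B + 2 * c * (1 - c) * y
        = (c\<^sup>2 * a + (1 - c)\<^sup>2 * b + 2 * c * (1 - c) * d) - 1/2"
      by (simp add: A_def B_def y_def field_simps power2_eq_square)
    thus ?thesis using e c by (simp only: edge_density_bipodal less_imp_le)
  qed
  have "c * A - (1 - c) * (\<delta> - y) = c\<^sup>2 * A - (1 - c)\<^sup>2 * B + 2 * c * (1 - c) * y"
    "c * (\<delta> + y) - (1 - c) * B = c\<^sup>2 * A - (1 - c)\<^sup>2 * B + 2 * c * (1 - c) * y"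
    by (simp_all add: \<delta>_def algebra_simps power2_eq_square)
  hence A: "c * A = (1 - c) * (\<delta> - y)" and B: "(1 - c) * B = c * (\<delta> + y)"
    using e0 by simp_all
  have "bipodal (a, b, c, d) = bipodal (1/2 + 1 * A, 1/2 - 1 * B, c, 1/2 + 1 * y)"
    by (simp add: A_def B_def y_def)
  hence "two_star_density (bipodal (a, b, c, d)) = c * (1 - c) * \<delta>\<^sup>2 + 1/4"
    using bipodal_centred_densities(2)[of c 1 A \<delta> y B] A B c by simp
  thus ?thesis using A B by (intro that[of \<delta>]) (simp_all add: A_def B_def y_def)
qed

text \<open>The weighted sum \<open>c\<^sup>2 A + (1 - c)\<^sup>2 B\<close> equals \<open>2 c (1 - c) \<delta>\<close> because the contributions of \<open>y\<close> cancel.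
  So the first-order term of the entropy depends on the cut point alone, and it is of second order in \<open>w\<close>.\<close>

lemma linear_shift:
  assumes w: "\<bar>w\<bar> < 1" and c: "c = (1 + w) / 2" and \<delta>: "\<delta> = \<alpha> / sqrt (1 - w\<^sup>2)"
    and A: "c * A = (1 - c) * (\<delta> - y)" and B: "(1 - c) * B = c * (\<delta> + y)"
  shows "c\<^sup>2 * (A - \<alpha>) + (1 - c)\<^sup>2 * (B - \<alpha>) = - (\<alpha> * w\<^sup>2 / 2) * (1 + 1 / (1 + sqrt (1 - w\<^sup>2)))"
proof -
  define \<kappa> where "\<kappa> = sqrt (1 - w\<^sup>2)"
  have w2: "w\<^sup>2 < 1" using w by (simp add: abs_square_less_1)
  have \<kappa>: "\<kappa> > 0" "\<kappa>\<^sup>2 = 1 - w\<^sup>2" using w2 by (auto simp: \<kappa>_def)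
  have "c\<^sup>2 * A + (1 - c)\<^sup>2 * B = c * (c * A) + (1 - c) * ((1 - c) * B)"
    by (simp add: power2_eq_square mult.assoc)
  also have "\<dots> = 2 * (c * (1 - c)) * \<delta>" unfolding A B by (simp add: algebra_simps)
  also have "2 * (c * (1 - c)) = \<kappa>\<^sup>2 / 2"
    unfolding \<kappa> c by (simp add: power2_eq_square field_simps)
  also have "\<kappa>\<^sup>2 / 2 * \<delta> = \<kappa> * \<alpha> / 2"
    using \<kappa>(1) unfolding \<delta> \<kappa>_def[symmetric] by (simp add: power2_eq_square)
  finally have first: "c\<^sup>2 * A + (1 - c)\<^sup>2 * B = \<kappa> * \<alpha> / 2" .
  have weight: "c\<^sup>2 + (1 - c)\<^sup>2 = (1 + w\<^sup>2) / 2" unfolding c by (simp add: power2_eq_square field_simps)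
  have "w\<^sup>2 = (1 - \<kappa>) * (1 + \<kappa>)" using \<kappa> by (simp add: algebra_simps power2_eq_square)
  moreover define r where "r = 1 / (1 + \<kappa>)"
  ultimately have r: "w\<^sup>2 * r = 1 - \<kappa>" using \<kappa> by simp
  have "c\<^sup>2 * (A - \<alpha>) + (1 - c)\<^sup>2 * (B - \<alpha>) = (c\<^sup>2 * A + (1 - c)\<^sup>2 * B) - \<alpha> * (c\<^sup>2 + (1 - c)\<^sup>2)"
    by (simp add: algebra_simps)
  also have "\<dots> = - (\<alpha> / 2) * (w\<^sup>2 + (1 - \<kappa>))"
    unfolding first weight by (simp add: algebra_simps)
  also have "\<dots> = - (\<alpha> * w\<^sup>2 / 2) * (1 + r)"
    unfolding r[symmetric] by (simp add: algebra_simps)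
  finally show ?thesis unfolding r_def \<kappa>_def .
qed

text \<open>The two squares are rewritten through the difference and the sum of \<open>(1 - c) (B - \<alpha>)\<close> and
  \<open>c (A - \<alpha>)\<close>. The sum \<open>\<delta> - \<alpha> + w y\<close> is of second order, so only the difference matters in the limit.\<close>

lemma quadratic_shift:
  fixes w :: real
  assumes c: "c = (1 + w) / 2"
    and A: "c * A = (1 - c) * (\<delta> - y)" and B: "(1 - c) * B = c * (\<delta> + y)"
  shows "c\<^sup>2 * (A - \<alpha>)\<^sup>2 + (1 - c)\<^sup>2 * (B - \<alpha>)\<^sup>2 =
    ((y + w * (\<delta> + \<alpha>))\<^sup>2 + (\<delta> - \<alpha> + w * y)\<^sup>2) / 2"
proof -
  have u: "c * (A - \<alpha>) = ((\<delta> - \<alpha> + w * y) - (y + w * (\<delta> + \<alpha>))) / 2"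
  proof -
    have "c * (A - \<alpha>) = (1 - c) * (\<delta> - y) - c * \<alpha>" using A by (simp add: algebra_simps)
    thus ?thesis unfolding c by (simp add: field_simps)
  qed
  have v: "(1 - c) * (B - \<alpha>) = ((\<delta> - \<alpha> + w * y) + (y + w * (\<delta> + \<alpha>))) / 2"
  proof -
    have "(1 - c) * (B - \<alpha>) = c * (\<delta> + y) - (1 - c) * \<alpha>" using B by (simp add: algebra_simps)
    thus ?thesis unfolding c by (simp add: field_simps)
  qed
  have "c\<^sup>2 * (A - \<alpha>)\<^sup>2 + (1 - c)\<^sup>2 * (B - \<alpha>)\<^sup>2 = (c * (A - \<alpha>))\<^sup>2 + ((1 - c) * (B - \<alpha>))\<^sup>2"
    by (simp add: power_mult_distrib)
  also have "\<dots> = ((y + w * (\<delta> + \<alpha>))\<^sup>2 + (\<delta> - \<alpha> + w * y)\<^sup>2) / 2"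
    unfolding u v by (simp add: field_simps power2_eq_square)
  finally show ?thesis .
qed

text \<open>The minimum over \<open>y\<close> of the quadratic loss: Cauchy-Schwarz applied to \<open>m = (y + m) - y\<close>.\<close>

lemma weighted_squares_ge:
  fixes k v :: real
  assumes "k > 0" "v > 0"
  shows "m\<^sup>2 / (k + 1 / v) \<le> (y + m)\<^sup>2 / k + v * y\<^sup>2"
proof -
  \<comment> \<open>The defect in the Cauchy-Schwarz inequality is a square.\<close>
  have "(k + 1 / v) * ((y + m)\<^sup>2 / k + v * y\<^sup>2) - m\<^sup>2 = ((y + m) + k * v * y)\<^sup>2 / (k * v)"
    using assms by (simp add: divide_simps) (simp add: algebra_simps power2_eq_square)
  moreover have "((y + m) + k * v * y)\<^sup>2 / (k * v) \<ge> 0" using assms by simp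
  ultimately have "m\<^sup>2 \<le> ((y + m)\<^sup>2 / k + v * y\<^sup>2) * (k + 1 / v)" by (simp add: mult.commute)
  thus ?thesis using assms by (subst pos_divide_le_eq) (auto intro: add_pos_pos)
qed

section \<open>Symmetric points with negative curvature are local maximizers\<close>

text \<open>Here \<open>\<rho>\<close> is a lower bound for the deviations of both diagonal blocks; as \<open>\<rho>\<close> tends to \<open>\<alpha>\<close> and \<open>w\<close> to
  \<open>0\<close>, the coefficient of \<open>w\<^sup>2\<close> tends to a quarter of \<open>tilt_curvature \<alpha>\<close>.\<close>

lemma entropy_le_second_order:
  assumes \<rho>: "0 < \<rho>" "\<rho> < \<alpha>" "\<alpha> < 1/2"
    and near: "\<rho> \<le> A" "A < 1/2" "\<rho> \<le> B" "B < 1/2" "\<bar>y\<bar> < 1/2"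
    and w: "\<bar>w\<bar> < 1" and c: "c = (1 + w) / 2" and \<delta>: "\<delta> = \<alpha> / sqrt (1 - w\<^sup>2)"
    and A: "c * A = (1 - c) * (\<delta> - y)" and B: "(1 - c) * B = c * (\<delta> + y)"
  shows "c\<^sup>2 * centred_entropy A + (1 - c)\<^sup>2 * centred_entropy B + 2 * c * (1 - c) * centred_entropy y
    \<le> (centred_entropy \<alpha> + centred_entropy 0) / 2
      + w\<^sup>2 * ((centred_entropy \<alpha> - centred_entropy 0) / 2
          - \<alpha> * entropy_slope \<alpha> / 2 * (1 + 1 / (1 + sqrt (1 - w\<^sup>2)))
          - 2 * \<alpha>\<^sup>2 / ((1 - 4 * \<rho>\<^sup>2) + 1 / (1 - w\<^sup>2)))"
proof -
  define k v m where "k = 1 - 4 * \<rho>\<^sup>2" and "v = 1 - w\<^sup>2" and "m = w * (\<delta> + \<alpha>)"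
  define h h0 h' where "h = centred_entropy \<alpha>" and "h0 = centred_entropy 0" and "h' = entropy_slope \<alpha>"
  define L where "L = c\<^sup>2 * (A - \<alpha>) + (1 - c)\<^sup>2 * (B - \<alpha>)"
  define Q where "Q = c\<^sup>2 * (A - \<alpha>)\<^sup>2 + (1 - c)\<^sup>2 * (B - \<alpha>)\<^sup>2"
  have "\<rho>\<^sup>2 < (1/2)\<^sup>2" using \<rho> by (intro power_strict_mono) auto
  hence k: "k > 0" by (simp add: k_def power2_eq_square)
  have v: "v > 0" using w by (simp add: v_def abs_square_less_1)
  have "sqrt v \<le> 1" "sqrt v > 0" using v by (auto simp: v_def)
  hence "\<alpha> \<le> \<delta>" using \<rho> unfolding \<delta> v_def[symmetric] by (simp add: pos_le_divide_eq mult_left_le)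
  hence "(2 * \<alpha>)\<^sup>2 \<le> (\<delta> + \<alpha>)\<^sup>2" using \<rho> by (intro power_mono) auto
  hence "w\<^sup>2 * (4 * \<alpha>\<^sup>2) \<le> m\<^sup>2"
    unfolding m_def power_mult_distrib by (intro mult_left_mono) auto
  hence "w\<^sup>2 * (4 * \<alpha>\<^sup>2) / (k + 1 / v) \<le> m\<^sup>2 / (k + 1 / v)"
    using k v by (intro divide_right_mono) (auto intro: add_nonneg_nonneg)
  also have "\<dots> \<le> (y + m)\<^sup>2 / k + v * y\<^sup>2" by (rule weighted_squares_ge[OF k v])
  also have "(y + m)\<^sup>2 / k \<le> 2 * Q / k"
    unfolding Q_def quadratic_shift[OF c A B] m_def using k by (intro divide_right_mono) auto
  finally have loss: "w\<^sup>2 * (4 * \<alpha>\<^sup>2 / (k + 1 / v)) \<le> 2 * Q / k + v * y\<^sup>2"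
    by (simp only: times_divide_eq_right mult.assoc)
  have weights: "c\<^sup>2 + (1 - c)\<^sup>2 = (1 + w\<^sup>2) / 2" "2 * c * (1 - c) = v / 2"
    unfolding c v_def by (simp_all add: power2_eq_square field_simps)
  have "c\<^sup>2 * centred_entropy A \<le> c\<^sup>2 * (h + h' * (A - \<alpha>) - (A - \<alpha>)\<^sup>2 / k)"
    unfolding h_def h'_def k_def using \<rho> near
    by (intro mult_left_mono centred_entropy_le_quadratic) auto
  moreover have "(1 - c)\<^sup>2 * centred_entropy B \<le> (1 - c)\<^sup>2 * (h + h' * (B - \<alpha>) - (B - \<alpha>)\<^sup>2 / k)"
    unfolding h_def h'_def k_def using \<rho> near
    by (intro mult_left_mono centred_entropy_le_quadratic) auto
  moreover have "v / 2 * centred_entropy y \<le> v / 2 * (h0 - y\<^sup>2)"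
    unfolding h0_def using v near by (intro mult_left_mono centred_entropy_le_cap) auto
  ultimately have "c\<^sup>2 * centred_entropy A + (1 - c)\<^sup>2 * centred_entropy B + v / 2 * centred_entropy y
      \<le> c\<^sup>2 * (h + h' * (A - \<alpha>) - (A - \<alpha>)\<^sup>2 / k)
        + (1 - c)\<^sup>2 * (h + h' * (B - \<alpha>) - (B - \<alpha>)\<^sup>2 / k) + v / 2 * (h0 - y\<^sup>2)"
    by linarith
  also have "\<dots> = (c\<^sup>2 + (1 - c)\<^sup>2) * h + h' * L - Q / k + v / 2 * h0 - v * y\<^sup>2 / 2"
    unfolding L_def Q_def add_divide_distrib by (simp add: algebra_simps)
  also have "\<dots> = (h + h0) / 2 + w\<^sup>2 * ((h - h0) / 2) + h' * L - (2 * Q / k + v * y\<^sup>2) / 2"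
    unfolding weights v_def by (simp add: field_simps)
  also have "\<dots> \<le> (h + h0) / 2 + w\<^sup>2 * ((h - h0) / 2) + h' * L - w\<^sup>2 * (4 * \<alpha>\<^sup>2 / (k + 1 / v)) / 2"
    by (rule diff_left_mono, rule divide_right_mono[OF loss]) simp
  also have "h' * L = w\<^sup>2 * (- \<alpha> * h' / 2 * (1 + 1 / (1 + sqrt v)))"
    unfolding L_def linear_shift[OF w c \<delta> A B] v_def by (simp add: mult_ac)
  finally have bound: "c\<^sup>2 * centred_entropy A + (1 - c)\<^sup>2 * centred_entropy B + v / 2 * centred_entropy y
      \<le> (h + h0) / 2 + w\<^sup>2 * ((h - h0) / 2) + w\<^sup>2 * (- \<alpha> * h' / 2 * (1 + 1 / (1 + sqrt v)))
        - w\<^sup>2 * (4 * \<alpha>\<^sup>2 / (k + 1 / v)) / 2" .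
  have "(h + h0) / 2 + w\<^sup>2 * ((h - h0) / 2) + w\<^sup>2 * (- \<alpha> * h' / 2 * s) - w\<^sup>2 * (4 * \<alpha>\<^sup>2 / K) / 2
      = (h + h0) / 2 + w\<^sup>2 * ((h - h0) / 2 - \<alpha> * h' / 2 * s - 2 * \<alpha>\<^sup>2 / K)" for s K
    by (simp add: algebra_simps)
  from bound[unfolded this] show ?thesis
    unfolding weights h_def h0_def h'_def k_def v_def .
qed

lemma entropy_bipodal_centred:
  assumes "0 \<le> c" "c \<le> 1"
  shows "graphon_entropy (bipodal (a, b, c, d)) = c\<^sup>2 * centred_entropy (a - 1/2)
    + (1 - c)\<^sup>2 * centred_entropy (1/2 - b) + 2 * c * (1 - c) * centred_entropy (d - 1/2)"
proof -
  have "centred_entropy (1/2 - b) = centred_entropy (b - 1/2)"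
    using centred_entropy_minus[of "b - 1/2"] by simp
  thus ?thesis
    by (simp add: graphon_entropy_bipodal[OF assms] centred_entropy_def)
qed

lemma abs_diff_less_of_dist_quadruple:
  fixes a b c d a' b' c' d' :: real
  assumes "dist (a, b, c, d) (a', b', c', d') < \<epsilon>"
  shows "\<bar>a - a'\<bar> < \<epsilon>" "\<bar>b - b'\<bar> < \<epsilon>" "\<bar>c - c'\<bar> < \<epsilon>" "\<bar>d - d'\<bar> < \<epsilon>"
proof -
  have *: "dist p p' < \<epsilon>" "dist q q' < \<epsilon>" if "dist (p, q) (p', q') < \<epsilon>"
    for p p' :: real and q q' :: "'a :: metric_space"
    using that dist_fst_le[of "(p, q)" "(p', q')"] dist_snd_le[of "(p, q)" "(p', q')"] by simp_all
  show "\<bar>a - a'\<bar> < \<epsilon>" "\<bar>b - b'\<bar> < \<epsilon>" "\<bar>c - c'\<bar> < \<epsilon>" "\<bar>d - d'\<bar> < \<epsilon>"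
    using *(1)[OF assms] *(1)[OF *(2)[OF assms]] *(1)[OF *(2)[OF *(2)[OF assms]]]
      *(2)[OF *(2)[OF *(2)[OF assms]]]
    by (simp_all only: dist_real_def)
qed

lemma symmetric_bipodal_params_iff:
  "(1/2 + \<alpha>, 1/2 - \<alpha>, 1/2, 1/2) \<in> bipodal_params (1/2) (t + 1/4) \<longleftrightarrow> \<bar>\<alpha>\<bar> \<le> 1/2 \<and> t = \<alpha>\<^sup>2 / 4"
  using bipodal_centred_densities[of "1/2" 1 \<alpha> \<alpha> 0 \<alpha>]
  by (auto simp: bipodal_params_def abs_le_iff)

lemma symmetric_bipodal_entropy:
  "graphon_entropy (bipodal (1/2 + \<alpha>, 1/2 - \<alpha>, 1/2, 1/2)) = (centred_entropy \<alpha> + centred_entropy 0) / 2"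
  by (simp add: entropy_bipodal_centred power2_eq_square)

text \<open>The constant graphon needs a separate argument, as there \<open>\<alpha> = 0\<close> and the curvature vanishes; but
  \<open>1/2\<close> maximizes the entropy density pointwise.\<close>

lemma constant_local_maximizer:
  "bipodal_local_maximizer (1/2) (1/4) (1/2, 1/2, 1/2, 1/2)"
  unfolding bipodal_local_maximizer_def
proof (intro conjI exI[of _ "1/4"] ballI impI)
  show "(1/2, 1/2, 1/2, 1/2) \<in> bipodal_params (1/2) (1/4)"
    using symmetric_bipodal_params_iff[of 0 0] by simp
  fix q :: "real \<times> real \<times> real \<times> real"
  assume near: "dist q (1/2, 1/2, 1/2, 1/2) < 1/4"
  obtain a b c d where q: "q = (a, b, c, d)" by (cases q)
  have abs: "\<bar>a - 1/2\<bar> < 1/2" "\<bar>b - 1/2\<bar> < 1/2" "\<bar>c - 1/2\<bar> < 1/2" "\<bar>d - 1/2\<bar> < 1/2"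
    using abs_diff_less_of_dist_quadruple[OF near[unfolded q]] by simp_all
  have le: "centred_entropy s \<le> centred_entropy 0" if "\<bar>s\<bar> < 1/2" for s
    using centred_entropy_le_cap[OF that] zero_le_power2[of s] by linarith
  have c: "0 \<le> c" "c \<le> 1" using abs(3) by - (linarith+)
  have "graphon_entropy (bipodal q) \<le> c\<^sup>2 * centred_entropy 0 + (1 - c)\<^sup>2 * centred_entropy 0
      + 2 * c * (1 - c) * centred_entropy 0"
    unfolding q entropy_bipodal_centred[OF c] using c abs
    by (intro add_mono mult_left_mono le) (auto simp: abs_minus_commute)
  also have "\<dots> = centred_entropy 0" by (simp add: algebra_simps power2_eq_square)
  also have "\<dots> = graphon_entropy (bipodal (1/2, 1/2, 1/2, 1/2))"
    using symmetric_bipodal_entropy[of 0] by simp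
  finally show "graphon_entropy (bipodal q) \<le> graphon_entropy (bipodal (1/2, 1/2, 1/2, 1/2))" .
qed simp

text \<open>First \<open>\<rho>\<close> is chosen so close to \<open>\<alpha>\<close> that the second-order coefficient is still negative at \<open>w = 0\<close>,
  then the neighbourhood so small that it stays negative and all deviations exceed \<open>\<rho>\<close>.\<close>

lemma local_maximizer_if_curvature_neg:
  assumes \<alpha>: "0 < \<alpha>" "\<alpha> < 1/2" and neg: "tilt_curvature \<alpha> < 0"
  shows "bipodal_local_maximizer (1/2) (\<alpha>\<^sup>2 / 4 + 1/4) (1/2 + \<alpha>, 1/2 - \<alpha>, 1/2, 1/2)"
proof -
  define \<Psi> where "\<Psi> \<rho> w = (centred_entropy \<alpha> - centred_entropy 0) / 2
      - \<alpha> * entropy_slope \<alpha> / 2 * (1 + 1 / (1 + sqrt (1 - w\<^sup>2)))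
      - 2 * \<alpha>\<^sup>2 / ((1 - 4 * \<rho>\<^sup>2) + 1 / (1 - w\<^sup>2))" for \<rho> w :: real
  have sq: "\<rho>\<^sup>2 < 1/4" if "0 \<le> \<rho>" "\<rho> < 1/2" for \<rho> :: real
    using that power_strict_mono[of \<rho> "1/2" 2] by (simp add: power2_eq_square)
  have lim_\<rho>: "((\<lambda>\<rho>. \<Psi> \<rho> 0) \<longlongrightarrow> \<Psi> \<alpha> 0) (at_left \<alpha>)"
    unfolding \<Psi>_def using sq[of \<alpha>] \<alpha> by (auto intro!: tendsto_eq_intros)
  define T where "T = \<alpha>\<^sup>2 / (1 - 2 * \<alpha>\<^sup>2)"
  have T: "4 * \<alpha>\<^sup>2 / (1 - 2 * \<alpha>\<^sup>2) = 4 * T" by (simp add: T_def)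
  have "2 * \<alpha>\<^sup>2 / (2 - 4 * \<alpha>\<^sup>2) = T"
    using sq[of \<alpha>] \<alpha> unfolding T_def by (simp add: divide_simps)
  hence \<Psi>_lim: "\<Psi> \<alpha> 0 = (centred_entropy \<alpha> - centred_entropy 0) / 2 - 3 * \<alpha> * entropy_slope \<alpha> / 4 - T"
    by (simp add: \<Psi>_def)
  have "\<Psi> \<alpha> 0 = tilt_curvature \<alpha> / 4"
    unfolding \<Psi>_lim tilt_curvature_def T by simp
  hence "eventually (\<lambda>\<rho>. \<Psi> \<rho> 0 < 0) (at_left \<alpha>)"
    using neg by (intro order_tendstoD(2)[OF lim_\<rho>]) auto
  moreover have "eventually (\<lambda>\<rho>. \<rho> \<in> {0<..<\<alpha>}) (at_left \<alpha>)"
    using \<alpha> by (intro eventually_at_left_real) auto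
  ultimately have "eventually (\<lambda>\<rho>. \<Psi> \<rho> 0 < 0 \<and> \<rho> \<in> {0<..<\<alpha>}) (at_left \<alpha>)"
    by eventually_elim auto
  then obtain \<rho> where \<rho>: "\<Psi> \<rho> 0 < 0" "0 < \<rho>" "\<rho> < \<alpha>"
    using eventually_happens[of _ "at_left \<alpha>"] by auto
  have "((\<lambda>w. \<Psi> \<rho> w) \<longlongrightarrow> \<Psi> \<rho> 0) (nhds 0)"
    unfolding \<Psi>_def using sq[of \<rho>] \<rho> \<alpha>
    by (auto intro!: tendsto_eq_intros filterlim_ident)
  hence "eventually (\<lambda>w. \<Psi> \<rho> w < 0) (nhds 0)"
    using \<rho> by (intro order_tendstoD(2)) auto
  then obtain \<eta> where \<eta>: "\<eta> > 0" "\<And>w. \<bar>w\<bar> < \<eta> \<Longrightarrow> \<Psi> \<rho> w < 0"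
    by (auto simp: eventually_nhds_metric dist_real_def)
  define \<epsilon> where "\<epsilon> = min (min (\<alpha> - \<rho>) (1/2 - \<alpha>)) (\<eta> / 2)"
  have "\<epsilon> > 0" unfolding \<epsilon>_def using \<alpha> \<rho> \<eta>(1) by simp
  moreover have "\<epsilon> \<le> \<alpha> - \<rho>" unfolding \<epsilon>_def by (rule min.coboundedI1[OF min.cobounded1])
  moreover have "\<epsilon> \<le> 1/2 - \<alpha>" unfolding \<epsilon>_def by (rule min.coboundedI1[OF min.cobounded2])
  moreover have "\<epsilon> \<le> \<eta> / 2" unfolding \<epsilon>_def by (rule min.cobounded2)
  ultimately have \<epsilon>: "\<epsilon> > 0" "\<epsilon> \<le> \<alpha> - \<rho>" "\<epsilon> \<le> 1/2 - \<alpha>" "\<epsilon> \<le> \<eta> / 2" .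
  show ?thesis
    unfolding bipodal_local_maximizer_def
  proof (intro conjI exI[of _ \<epsilon>] ballI impI)
    show "(1/2 + \<alpha>, 1/2 - \<alpha>, 1/2, 1/2) \<in> bipodal_params (1/2) (\<alpha>\<^sup>2 / 4 + 1/4)"
      using \<alpha> by (simp only: symmetric_bipodal_params_iff) auto
    show "\<epsilon> > 0" by fact
    fix q :: "real \<times> real \<times> real \<times> real"
    assume q: "q \<in> bipodal_params (1/2) (\<alpha>\<^sup>2 / 4 + 1/4)"
      and near: "dist q (1/2 + \<alpha>, 1/2 - \<alpha>, 1/2, 1/2) < \<epsilon>"
    obtain a b c d where abcd: "q = (a, b, c, d)" by (cases q)
    define A B y w where "A = a - 1/2" and "B = 1/2 - b" and "y = d - 1/2" and "w = 2 * c - 1"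
    note dist = abs_diff_less_of_dist_quadruple[OF near[unfolded abcd]]
    have close: "\<bar>A - \<alpha>\<bar> < \<epsilon>" "\<bar>B - \<alpha>\<bar> < \<epsilon>" "\<bar>w\<bar> < 2 * \<epsilon>" "\<bar>y\<bar> < \<epsilon>"
      subgoal using dist(1) unfolding A_def by linarith
      subgoal using dist(2) unfolding B_def by linarith
      subgoal using dist(3) unfolding w_def by linarith
      subgoal using dist(4) unfolding y_def .
      done
    have w: "\<bar>w\<bar> < 1" using close(3) \<epsilon> \<alpha> by linarith
    have "c = (1 + w) / 2" by (simp add: w_def)
    moreover have "0 < (1 + w) / 2" "(1 + w) / 2 < 1" using w by (auto simp: abs_less_iff)
    ultimately have c: "0 < c" "c < 1" "c = (1 + w) / 2" "\<bar>w\<bar> < 1" using w by simp_all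
    have dens: "edge_density (bipodal (a, b, c, d)) = 1/2"
        "two_star_density (bipodal (a, b, c, d)) = \<alpha>\<^sup>2 / 4 + 1/4"
      using q unfolding bipodal_params_def abcd by simp_all
    obtain \<delta> where \<delta>: "c * A = (1 - c) * (\<delta> - y)" "(1 - c) * B = c * (\<delta> + y)"
        "two_star_density (bipodal (a, b, c, d)) = c * (1 - c) * \<delta>\<^sup>2 + 1/4"
      by (rule bipodal_centred_coordinates[OF c(1,2) dens(1), folded A_def B_def y_def])
    have \<delta>_sq: "c * (1 - c) * \<delta>\<^sup>2 = \<alpha>\<^sup>2 / 4" using \<delta>(3) dens(2) by simp
    have AB: "\<rho> \<le> A" "A < 1/2" "\<rho> \<le> B" "B < 1/2" "\<bar>y\<bar> < 1/2"
      using close(1,2,4) \<epsilon>(2,3) \<rho>(2) \<alpha>(1) unfolding abs_less_iff by linarith+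
    have w2: "w\<^sup>2 < 1" using c by (simp add: abs_square_less_1)
    \<comment> \<open>The density only determines the square of \<open>\<delta>\<close>; the blocks are close enough to fix its sign.\<close>
    have "2 * (c * (1 - c)) * \<delta> = c * (c * A) + (1 - c) * ((1 - c) * B)"
      unfolding \<delta>(1,2) by (simp add: algebra_simps)
    also have "\<dots> > 0" using c AB \<rho> by (intro add_pos_pos mult_pos_pos) auto
    finally have "\<delta> > 0" by (rule zero_less_mult_pos) (use c in simp)
    moreover have "(1 - w\<^sup>2) * \<delta>\<^sup>2 = \<alpha>\<^sup>2"
      using \<delta>_sq unfolding c(3) by (simp add: field_simps power2_eq_square)
    hence "sqrt ((1 - w\<^sup>2) * \<delta>\<^sup>2) = \<alpha>" using \<alpha> by simp
    ultimately have "\<alpha> = sqrt (1 - w\<^sup>2) * \<delta>"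
      by (simp add: real_sqrt_mult)
    hence \<delta>_eq: "\<delta> = \<alpha> / sqrt (1 - w\<^sup>2)"
      using w2 by simp
    have "graphon_entropy (bipodal q) = c\<^sup>2 * centred_entropy A + (1 - c)\<^sup>2 * centred_entropy B
        + 2 * c * (1 - c) * centred_entropy y"
      using c unfolding abcd A_def B_def y_def by (intro entropy_bipodal_centred) auto
    also have "\<dots> \<le> (centred_entropy \<alpha> + centred_entropy 0) / 2 + w\<^sup>2 * \<Psi> \<rho> w"
      unfolding \<Psi>_def
      by (rule entropy_le_second_order[OF \<rho>(2,3) \<alpha>(2) AB c(4,3) \<delta>_eq \<delta>(1,2)])
    also have "\<dots> \<le> (centred_entropy \<alpha> + centred_entropy 0) / 2"
    proof -
      have "\<Psi> \<rho> w < 0" using close(3) \<epsilon>(4) by (intro \<eta>(2)) linarith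
      hence "w\<^sup>2 * \<Psi> \<rho> w \<le> 0" by (intro mult_nonneg_nonpos) auto
      thus ?thesis by linarith
    qed
    also have "\<dots> = graphon_entropy (bipodal (1/2 + \<alpha>, 1/2 - \<alpha>, 1/2, 1/2))"
      by (simp only: symmetric_bipodal_entropy)
    finally show "graphon_entropy (bipodal q) \<le> graphon_entropy (bipodal (1/2 + \<alpha>, 1/2 - \<alpha>, 1/2, 1/2))" .
  qed
qed

section \<open>Symmetric points with positive curvature are not local maximizers\<close>

text \<open>Deviations of the two diagonal blocks on the curve \<open>y = - \<mu> w\<close> in the constraint surface: these are
  \<open>A\<close> and \<open>B\<close> solved from \<open>c A = (1 - c) (\<delta> - y)\<close> and \<open>(1 - c) B = c (\<delta> + y)\<close> for \<open>c = (1 + w)/2\<close>.\<close>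

definition tilted_upper :: "real \<Rightarrow> real \<Rightarrow> real \<Rightarrow> real" where
  "tilted_upper \<alpha> \<mu> w = (\<alpha> / sqrt (1 - w\<^sup>2) + \<mu> * w) * (1 - w) / (1 + w)"

definition tilted_lower :: "real \<Rightarrow> real \<Rightarrow> real \<Rightarrow> real" where
  "tilted_lower \<alpha> \<mu> w = (\<alpha> / sqrt (1 - w\<^sup>2) - \<mu> * w) * (1 + w) / (1 - w)"

definition tilted_entropy :: "real \<Rightarrow> real \<Rightarrow> real \<Rightarrow> real" where
  "tilted_entropy \<alpha> \<mu> w = ((1 + w) / 2)\<^sup>2 * centred_entropy (tilted_upper \<alpha> \<mu> w)
     + ((1 - w) / 2)\<^sup>2 * centred_entropy (tilted_lower \<alpha> \<mu> w)
     + (1 - w\<^sup>2) / 2 * centred_entropy (\<mu> * w)"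

lemma tilted_upper_eq:
  assumes "\<bar>w\<bar> < 1" "c = (1 + w) / 2"
  shows "c * tilted_upper \<alpha> \<mu> w = (1 - c) * (\<alpha> / sqrt (1 - w\<^sup>2) - (- \<mu> * w))"
proof -
  have "(1 + w) / 2 * (s * (1 - w) / (1 + w)) = (1 - (1 + w) / 2) * s" for s
    using assms(1) by (simp add: field_simps)
  thus ?thesis unfolding tilted_upper_def assms(2) by simp
qed

lemma tilted_lower_eq:
  assumes "\<bar>w\<bar> < 1" "c = (1 + w) / 2"
  shows "(1 - c) * tilted_lower \<alpha> \<mu> w = c * (\<alpha> / sqrt (1 - w\<^sup>2) + (- \<mu> * w))"
proof -
  have "(1 - (1 + w) / 2) * (s * (1 + w) / (1 - w)) = (1 + w) / 2 * s" for s
    using assms(1) by (simp add: field_simps)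
  thus ?thesis unfolding tilted_lower_def assms(2) by simp
qed

lemma tendsto_tilted:
  "((\<lambda>w. tilted_upper \<alpha> \<mu> w) \<longlongrightarrow> \<alpha>) (at_right 0)" "((\<lambda>w. tilted_lower \<alpha> \<mu> w) \<longlongrightarrow> \<alpha>) (at_right 0)"
  unfolding tilted_upper_def tilted_lower_def by (auto intro!: tendsto_eq_intros)

text \<open>Along the curve the parameters converge to the symmetric point as \<open>w\<close> decreases to \<open>0\<close>. The sign
  \<open>\<sigma>\<close> covers the symmetric points with \<open>a < 1/2\<close>, since complementation does not change the entropy.\<close>

lemma not_local_maximizer_by_tilting:
  assumes sign: "\<sigma> = 1 \<or> \<sigma> = - 1"
    and gain: "eventually (\<lambda>w. \<bar>tilted_upper \<alpha> \<mu> w\<bar> \<le> 1/2 \<and> \<bar>tilted_lower \<alpha> \<mu> w\<bar> \<le> 1/2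
      \<and> (centred_entropy \<alpha> + centred_entropy 0) / 2 < tilted_entropy \<alpha> \<mu> w) (at_right 0)"
  shows "\<not> bipodal_local_maximizer (1/2) (\<alpha>\<^sup>2 / 4 + 1/4) (1/2 + \<sigma> * \<alpha>, 1/2 - \<sigma> * \<alpha>, 1/2, 1/2)"
    (is "\<not> bipodal_local_maximizer _ _ ?p")
proof
  assume "bipodal_local_maximizer (1/2) (\<alpha>\<^sup>2 / 4 + 1/4) ?p"
  then obtain \<epsilon> where \<epsilon>: "\<epsilon> > 0"
    and max: "\<And>q. q \<in> bipodal_params (1/2) (\<alpha>\<^sup>2 / 4 + 1/4) \<Longrightarrow> dist q ?p < \<epsilon> \<Longrightarrow>
      graphon_entropy (bipodal q) \<le> graphon_entropy (bipodal ?p)"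
    by (auto simp: bipodal_local_maximizer_def)
  let ?A = "tilted_upper \<alpha> \<mu>" and ?B = "tilted_lower \<alpha> \<mu>"
  let ?q = "\<lambda>w. (1/2 + \<sigma> * ?A w, 1/2 - \<sigma> * ?B w, (1 + w) / 2, 1/2 + \<sigma> * (- \<mu> * w))"
  have "(?q \<longlongrightarrow> ?p) (at_right 0)"
    by (auto intro!: tendsto_eq_intros tendsto_tilted)
  hence "eventually (\<lambda>w. dist (?q w) ?p < \<epsilon>) (at_right 0)"
    using \<epsilon> by (rule tendstoD)
  moreover have "((\<lambda>w. \<mu> * w) \<longlongrightarrow> 0) (at_right 0)"
    by (auto intro!: tendsto_eq_intros)
  hence "eventually (\<lambda>w. \<bar>\<mu> * w\<bar> < 1/2) (at_right 0)"
    using tendstoD[of "\<lambda>w. \<mu> * w" 0 "at_right 0" "1/2"] by (simp add: dist_real_def)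
  moreover have "eventually (\<lambda>w::real. w \<in> {0<..<1}) (at_right 0)"
    by (intro eventually_at_right_real) auto
  ultimately have "eventually (\<lambda>w. dist (?q w) ?p < \<epsilon> \<and> \<bar>\<mu> * w\<bar> < 1/2 \<and> w \<in> {0<..<1}
      \<and> \<bar>?A w\<bar> \<le> 1/2 \<and> \<bar>?B w\<bar> \<le> 1/2
      \<and> (centred_entropy \<alpha> + centred_entropy 0) / 2 < tilted_entropy \<alpha> \<mu> w) (at_right 0)"
    using gain by eventually_elim auto
  then obtain w where w: "dist (?q w) ?p < \<epsilon>" "\<bar>\<mu> * w\<bar> < 1/2" "0 < w" "w < 1"
      "\<bar>?A w\<bar> \<le> 1/2" "\<bar>?B w\<bar> \<le> 1/2"
      "(centred_entropy \<alpha> + centred_entropy 0) / 2 < tilted_entropy \<alpha> \<mu> w"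
    using eventually_happens[of _ "at_right (0::real)"] by auto
  define c where "c = (1 + w) / 2"
  have c: "0 \<le> c" "c \<le> 1" using w by (auto simp: c_def)
  have sign2: "\<sigma>\<^sup>2 = 1" using sign by auto
  have "\<bar>w\<bar> < 1" using w by simp
  note tilt = tilted_upper_eq[OF this c_def, of \<alpha> \<mu>] tilted_lower_eq[OF this c_def, of \<alpha> \<mu>]
  have "w\<^sup>2 < 1" using w by (simp add: abs_square_less_1)
  hence "c * (1 - c) * (\<alpha> / sqrt (1 - w\<^sup>2))\<^sup>2 = \<alpha>\<^sup>2 / 4"
    unfolding c_def by (simp add: power_divide field_simps power2_eq_square[of w])
  moreover have box: "1/2 + \<sigma> * s \<in> {0..1}" "1/2 - \<sigma> * s \<in> {0..1}" if "\<bar>s\<bar> \<le> 1/2" for s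
    using sign that by (auto simp: abs_le_iff)
  have "\<bar>- \<mu> * w\<bar> \<le> 1/2" using w by simp
  note box(1)[OF w(5)] box(2)[OF w(6)] box(1)[OF this]
  ultimately have "?q w \<in> bipodal_params (1/2) (\<alpha>\<^sup>2 / 4 + 1/4)"
    using bipodal_centred_densities[OF c sign2 tilt] c
    unfolding bipodal_params_def c_def[symmetric] by simp
  hence "graphon_entropy (bipodal (?q w)) \<le> graphon_entropy (bipodal ?p)"
    using w(1) by (rule max)
  moreover have "graphon_entropy (bipodal (?q w)) = tilted_entropy \<alpha> \<mu> w"
  proof -
    have weights: "1 - c = (1 - w) / 2" "2 * c * ((1 - w) / 2) = (1 - w\<^sup>2) / 2"
      unfolding c_def by (simp_all add: field_simps power2_eq_square)
    show ?thesis
      unfolding tilted_entropy_def c_def[symmetric] entropy_bipodal_centred[OF c] weights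
      using sign by auto
  qed
  moreover have "graphon_entropy (bipodal ?p) = (centred_entropy \<alpha> + centred_entropy 0) / 2"
    unfolding symmetric_bipodal_entropy using sign by auto
  ultimately show False using w(7) by simp
qed

text \<open>The counterpart of \<open>entropy_le_second_order\<close>, with upper bounds \<open>\<rho>\<close> and \<open>\<eta>\<close> for the deviations. The
  part of the quadratic loss that is of fourth order has to be kept here, because it counts against the
  curve.\<close>

lemma tilted_entropy_ge_second_order:
  assumes \<rho>: "0 \<le> \<alpha>" "\<alpha> \<le> \<rho>" "\<rho> < 1/2" and near: "\<bar>tilted_upper \<alpha> \<mu> w\<bar> \<le> \<rho>" "\<bar>tilted_lower \<alpha> \<mu> w\<bar> \<le> \<rho>"
    and \<eta>: "\<bar>\<mu> * w\<bar> \<le> \<eta>" "\<eta> < 1/2" and w: "0 < w" "w < 1"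
  defines "\<kappa> \<equiv> sqrt (1 - w\<^sup>2)"
  shows "(centred_entropy \<alpha> + centred_entropy 0) / 2
      + w\<^sup>2 * ((centred_entropy \<alpha> - centred_entropy 0) / 2
          - \<alpha> * entropy_slope \<alpha> / 2 * (1 + 1 / (1 + \<kappa>))
          - ((\<alpha> / \<kappa> + \<alpha> - \<mu>)\<^sup>2 + w\<^sup>2 * (\<alpha> / (\<kappa> * (1 + \<kappa>)) - \<mu>)\<^sup>2) / (2 * (1 - 4 * \<rho>\<^sup>2))
          - (1 - w\<^sup>2) * \<mu>\<^sup>2 / (2 * (1 - 4 * \<eta>\<^sup>2)))
    \<le> tilted_entropy \<alpha> \<mu> w"
proof -
  define A B y c \<delta> where "A = tilted_upper \<alpha> \<mu> w" and "B = tilted_lower \<alpha> \<mu> w"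
    and "y = - \<mu> * w" and "c = (1 + w) / 2" and "\<delta> = \<alpha> / sqrt (1 - w\<^sup>2)"
  define k k' where "k = 1 - 4 * \<rho>\<^sup>2" and "k' = 1 - 4 * \<eta>\<^sup>2"
  define h h0 h' where "h = centred_entropy \<alpha>" and "h0 = centred_entropy 0" and "h' = entropy_slope \<alpha>"
  define L where "L = c\<^sup>2 * (A - \<alpha>) + (1 - c)\<^sup>2 * (B - \<alpha>)"
  define Q where "Q = c\<^sup>2 * (A - \<alpha>)\<^sup>2 + (1 - c)\<^sup>2 * (B - \<alpha>)\<^sup>2"
  have w1: "\<bar>w\<bar> < 1" using w by simp
  have v: "0 < 1 - w\<^sup>2" using w1 by (simp add: abs_square_less_1)
  have \<kappa>: "\<kappa> > 0" "\<kappa>\<^sup>2 = 1 - w\<^sup>2" using v by (auto simp: \<kappa>_def)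
  note tilt = tilted_upper_eq[OF w1 c_def, of \<alpha> \<mu>, folded A_def y_def \<delta>_def]
    tilted_lower_eq[OF w1 c_def, of \<alpha> \<mu>, folded B_def y_def \<delta>_def]
  have weights: "c\<^sup>2 + (1 - c)\<^sup>2 = (1 + w\<^sup>2) / 2" "1 - c = (1 - w) / 2"
    unfolding c_def by (simp_all add: power2_eq_square field_simps)
  have w2: "w\<^sup>2 = (1 - \<kappa>) * (1 + \<kappa>)" using \<kappa> by (simp add: algebra_simps power2_eq_square)
  have "(1 - \<kappa>) * (1 + \<kappa>) * (\<alpha> / (\<kappa> * (1 + \<kappa>))) = (1 - \<kappa>) * (\<alpha> / \<kappa>)"
    using \<kappa>(1) by simp
  also have "\<dots> = \<delta> - \<alpha>"
    using \<kappa>(1) unfolding \<delta>_def \<kappa>_def[symmetric] by (simp add: field_simps)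
  finally have "w\<^sup>2 * (\<alpha> / (\<kappa> * (1 + \<kappa>))) = \<delta> - \<alpha>"
    unfolding w2 .
  hence sum: "\<delta> - \<alpha> + w * y = w * (w * (\<alpha> / (\<kappa> * (1 + \<kappa>)) - \<mu>))"
    by (simp add: y_def algebra_simps power2_eq_square)
  have diff: "y + w * (\<delta> + \<alpha>) = w * (\<alpha> / \<kappa> + \<alpha> - \<mu>)"
    unfolding \<delta>_def y_def \<kappa>_def by (simp add: algebra_simps)
  have factor: "((w * p)\<^sup>2 + (w * (w * r))\<^sup>2) / 2 = w\<^sup>2 * ((p\<^sup>2 + w\<^sup>2 * r\<^sup>2) / 2)" for p r
    by (simp add: power_mult_distrib algebra_simps)
  have Q: "Q = w\<^sup>2 * (((\<alpha> / \<kappa> + \<alpha> - \<mu>)\<^sup>2 + w\<^sup>2 * (\<alpha> / (\<kappa> * (1 + \<kappa>)) - \<mu>)\<^sup>2) / 2)"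
    unfolding Q_def quadratic_shift[OF c_def tilt] sum diff factor ..
  have "c\<^sup>2 * (h + h' * (A - \<alpha>) - (A - \<alpha>)\<^sup>2 / k) \<le> c\<^sup>2 * centred_entropy A"
    unfolding h_def h'_def k_def A_def using \<rho> near
    by (intro mult_left_mono centred_entropy_ge_quadratic) auto
  moreover have "(1 - c)\<^sup>2 * (h + h' * (B - \<alpha>) - (B - \<alpha>)\<^sup>2 / k) \<le> (1 - c)\<^sup>2 * centred_entropy B"
    unfolding h_def h'_def k_def B_def using \<rho> near
    by (intro mult_left_mono centred_entropy_ge_quadratic) auto
  moreover have "h0 - (\<mu> * w)\<^sup>2 / k' \<le> centred_entropy (\<mu> * w)"
    using centred_entropy_ge_quadratic[of 0 \<eta> "\<mu> * w"] \<eta> unfolding h0_def k'_def by simp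
  hence "(1 - w\<^sup>2) / 2 * (h0 - (\<mu> * w)\<^sup>2 / k') \<le> (1 - w\<^sup>2) / 2 * centred_entropy (\<mu> * w)"
    using v by (intro mult_left_mono) auto
  ultimately have "c\<^sup>2 * (h + h' * (A - \<alpha>) - (A - \<alpha>)\<^sup>2 / k)
        + (1 - c)\<^sup>2 * (h + h' * (B - \<alpha>) - (B - \<alpha>)\<^sup>2 / k) + (1 - w\<^sup>2) / 2 * (h0 - (\<mu> * w)\<^sup>2 / k')
      \<le> c\<^sup>2 * centred_entropy A + (1 - c)\<^sup>2 * centred_entropy B + (1 - w\<^sup>2) / 2 * centred_entropy (\<mu> * w)"
    by linarith
  also have "\<dots> = tilted_entropy \<alpha> \<mu> w"
    unfolding tilted_entropy_def A_def B_def weights(2) unfolding c_def ..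
  also have "c\<^sup>2 * (h + h' * (A - \<alpha>) - (A - \<alpha>)\<^sup>2 / k)
        + (1 - c)\<^sup>2 * (h + h' * (B - \<alpha>) - (B - \<alpha>)\<^sup>2 / k) + (1 - w\<^sup>2) / 2 * (h0 - (\<mu> * w)\<^sup>2 / k')
      = (c\<^sup>2 + (1 - c)\<^sup>2) * h + h' * L - Q / k + (1 - w\<^sup>2) / 2 * h0 - w\<^sup>2 * ((1 - w\<^sup>2) * \<mu>\<^sup>2 / (2 * k'))"
    unfolding L_def Q_def add_divide_distrib by (simp add: algebra_simps)
  also have "\<dots> = (h + h0) / 2 + w\<^sup>2 * ((h - h0) / 2) + h' * L - Q / k - w\<^sup>2 * ((1 - w\<^sup>2) * \<mu>\<^sup>2 / (2 * k'))"
    unfolding weights(1) by (simp add: field_simps)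
  also have "h' * L = w\<^sup>2 * (- \<alpha> * h' / 2 * (1 + 1 / (1 + \<kappa>)))"
    unfolding L_def linear_shift[OF w1 c_def \<delta>_def tilt] \<kappa>_def by (simp add: mult_ac)
  finally have bound: "(h + h0) / 2 + w\<^sup>2 * ((h - h0) / 2) + w\<^sup>2 * (- \<alpha> * h' / 2 * (1 + 1 / (1 + \<kappa>)))
      - Q / k - w\<^sup>2 * ((1 - w\<^sup>2) * \<mu>\<^sup>2 / (2 * k')) \<le> tilted_entropy \<alpha> \<mu> w" .
  have "(h + h0) / 2 + w\<^sup>2 * ((h - h0) / 2) + w\<^sup>2 * (- \<alpha> * h' / 2 * s) - w\<^sup>2 * (X / 2) / k - w\<^sup>2 * Y
      = (h + h0) / 2 + w\<^sup>2 * ((h - h0) / 2 - \<alpha> * h' / 2 * s - X / (2 * k) - Y)" for s X Y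
    by (simp add: algebra_simps)
  from bound[unfolded Q this] show ?thesis
    unfolding h_def h0_def h'_def k_def k'_def .
qed

text \<open>The slope \<open>\<mu>\<close> is the minimizer of \<open>(2 \<alpha> - \<mu>)\<^sup>2 / (1 - 4 \<alpha>\<^sup>2) + \<mu>\<^sup>2\<close>, the limiting quadratic loss per
  \<open>w\<^sup>2 / 2\<close>. The minimum is \<open>2 \<alpha>\<^sup>2 / (1 - 2 \<alpha>\<^sup>2)\<close>. A single small \<open>s\<close> serves as the slack in
  both upper bounds on the deviations.\<close>

lemma not_local_maximizer_if_curvature_pos:
  assumes sign: "\<sigma> = 1 \<or> \<sigma> = - 1" and \<alpha>: "0 < \<alpha>" "\<alpha> < 1/2" and pos: "0 < tilt_curvature \<alpha>"
  shows "\<not> bipodal_local_maximizer (1/2) (\<alpha>\<^sup>2 / 4 + 1/4) (1/2 + \<sigma> * \<alpha>, 1/2 - \<sigma> * \<alpha>, 1/2, 1/2)"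
proof (rule not_local_maximizer_by_tilting[OF sign])
  define \<mu> where "\<mu> = \<alpha> / (1 - 2 * \<alpha>\<^sup>2)"
  define \<Psi> where "\<Psi> s w = (centred_entropy \<alpha> - centred_entropy 0) / 2
      - \<alpha> * entropy_slope \<alpha> / 2 * (1 + 1 / (1 + sqrt (1 - w\<^sup>2)))
      - ((\<alpha> / sqrt (1 - w\<^sup>2) + \<alpha> - \<mu>)\<^sup>2
          + w\<^sup>2 * (\<alpha> / (sqrt (1 - w\<^sup>2) * (1 + sqrt (1 - w\<^sup>2))) - \<mu>)\<^sup>2) / (2 * (1 - 4 * (\<alpha> + s)\<^sup>2))
      - (1 - w\<^sup>2) * \<mu>\<^sup>2 / (2 * (1 - 4 * s\<^sup>2))" for s w :: real
  have sq: "\<rho>\<^sup>2 < 1/4" if "0 \<le> \<rho>" "\<rho> < 1/2" for \<rho> :: real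
    using that power_strict_mono[of \<rho> "1/2" 2] by (simp add: power2_eq_square)
  have \<alpha>2: "\<alpha>\<^sup>2 < 1/4" using sq[of \<alpha>] \<alpha> by simp
  have lim_s: "((\<lambda>s. \<Psi> s 0) \<longlongrightarrow> \<Psi> 0 0) (at_right 0)"
    unfolding \<Psi>_def using \<alpha>2 by (auto intro!: tendsto_eq_intros)
  define T where "T = \<alpha>\<^sup>2 / (1 - 2 * \<alpha>\<^sup>2)"
  have T: "4 * \<alpha>\<^sup>2 / (1 - 2 * \<alpha>\<^sup>2) = 4 * T" by (simp add: T_def)
  have "(2 * \<alpha> - \<mu>)\<^sup>2 / (2 * (1 - 4 * \<alpha>\<^sup>2)) + \<mu>\<^sup>2 / 2 = T"
  proof -
    define K where "K = 1 - 4 * \<alpha>\<^sup>2"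
    define J where "J = 1 - 2 * \<alpha>\<^sup>2"
    have pos: "K > 0" "J > 0" and KJ: "K + 1 = 2 * J" using \<alpha>2 by (simp_all add: K_def J_def)
    have \<mu>: "\<alpha> = \<mu> * J" using pos unfolding \<mu>_def J_def[symmetric] by simp
    have "2 * \<alpha> - \<mu> = \<mu> * (2 * J - 1)" unfolding \<mu> by (simp add: algebra_simps)
    also have "2 * J - 1 = K" using KJ by simp
    finally have "(2 * \<alpha> - \<mu>)\<^sup>2 / (2 * K) + \<mu>\<^sup>2 / 2 = \<mu>\<^sup>2 * (K + 1) / 2"
      using pos by (simp add: power_mult_distrib field_simps power2_eq_square)
    also have "\<dots> = \<alpha>\<^sup>2 / J"
      unfolding KJ \<mu> using pos by (simp add: power_mult_distrib power2_eq_square)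
    finally show ?thesis by (simp add: K_def J_def T_def)
  qed
  moreover have "\<Psi> 0 0 = (centred_entropy \<alpha> - centred_entropy 0) / 2
      - 3 * \<alpha> * entropy_slope \<alpha> / 4 - ((2 * \<alpha> - \<mu>)\<^sup>2 / (2 * (1 - 4 * \<alpha>\<^sup>2)) + \<mu>\<^sup>2 / 2)"
    by (simp add: \<Psi>_def)
  ultimately have \<Psi>_lim: "\<Psi> 0 0 = (centred_entropy \<alpha> - centred_entropy 0) / 2
      - 3 * \<alpha> * entropy_slope \<alpha> / 4 - T"
    by (simp only:)
  have "\<Psi> 0 0 = tilt_curvature \<alpha> / 4"
    unfolding \<Psi>_lim tilt_curvature_def T by simp
  hence "eventually (\<lambda>s. 0 < \<Psi> s 0) (at_right 0)"
    using pos by (intro order_tendstoD(1)[OF lim_s]) auto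
  moreover have "eventually (\<lambda>s. s \<in> {0<..<1/2 - \<alpha>}) (at_right 0)"
    using \<alpha> by (intro eventually_at_right_real) auto
  ultimately have "eventually (\<lambda>s. 0 < \<Psi> s 0 \<and> s \<in> {0<..<1/2 - \<alpha>}) (at_right 0)"
    by eventually_elim auto
  then obtain s where s: "0 < \<Psi> s 0" "0 < s" "s < 1/2 - \<alpha>"
    using eventually_happens[of _ "at_right (0::real)"] by auto
  have "((\<lambda>w. \<Psi> s w) \<longlongrightarrow> \<Psi> s 0) (at_right 0)"
    unfolding \<Psi>_def using sq[of s] sq[of "\<alpha> + s"] s \<alpha> by (auto intro!: tendsto_eq_intros)
  hence "eventually (\<lambda>w. 0 < \<Psi> s w) (at_right 0)"
    using s by (intro order_tendstoD(1)) auto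
  moreover have "eventually (\<lambda>w. \<bar>tilted_upper \<alpha> \<mu> w\<bar> < \<alpha> + s) (at_right 0)"
    "eventually (\<lambda>w. \<bar>tilted_lower \<alpha> \<mu> w\<bar> < \<alpha> + s) (at_right 0)"
    using s \<alpha> by (auto intro: order_tendstoD(2)[OF tendsto_rabs[OF tendsto_tilted(1)]]
      order_tendstoD(2)[OF tendsto_rabs[OF tendsto_tilted(2)]])
  moreover have "((\<lambda>w. \<bar>\<mu> * w\<bar>) \<longlongrightarrow> 0) (at_right 0)"
    by (auto intro!: tendsto_eq_intros)
  hence "eventually (\<lambda>w. \<bar>\<mu> * w\<bar> < s) (at_right 0)"
    using s by (intro order_tendstoD(2)) auto
  moreover have "eventually (\<lambda>w::real. w \<in> {0<..<1}) (at_right 0)"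
    by (intro eventually_at_right_real) auto
  ultimately show "eventually (\<lambda>w. \<bar>tilted_upper \<alpha> \<mu> w\<bar> \<le> 1/2 \<and> \<bar>tilted_lower \<alpha> \<mu> w\<bar> \<le> 1/2
      \<and> (centred_entropy \<alpha> + centred_entropy 0) / 2 < tilted_entropy \<alpha> \<mu> w) (at_right 0)"
  proof eventually_elim
    case (elim w)
    have "(centred_entropy \<alpha> + centred_entropy 0) / 2 + w\<^sup>2 * \<Psi> s w \<le> tilted_entropy \<alpha> \<mu> w"
      unfolding \<Psi>_def using elim s \<alpha> by (intro tilted_entropy_ge_second_order) auto
    moreover have "w\<^sup>2 * \<Psi> s w > 0" using elim by simp
    ultimately have "(centred_entropy \<alpha> + centred_entropy 0) / 2 < tilted_entropy \<alpha> \<mu> w"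
      by linarith
    thus ?case using elim s by auto
  qed
qed

section \<open>The extreme symmetric point\<close>

text \<open>At \<open>\<alpha> = 1/2\<close> the diagonal blocks have the values \<open>0\<close> and \<open>1\<close>, so a curve must move both of them
  inwards. To first order \<open>A\<close> is \<open>1/2 + (\<mu> - 1) w\<close> and \<open>B\<close> is \<open>1/2 - (\<mu> - 1) w\<close>, which leaves
  the slope \<open>\<mu> = 1\<close> only.\<close>

lemma tilted_half_le:
  assumes "0 < w" "w \<le> 1/2"
  shows "tilted_upper (1/2) 1 w \<le> 1/2" "tilted_lower (1/2) 1 w \<le> 1/2"
proof -
  have w2: "0 < 1 - w\<^sup>2" using assms by (simp add: abs_square_less_1)
  have "1 - w\<^sup>2 \<le> sqrt (1 - w\<^sup>2)"
    using w2 by (intro real_le_rsqrt) (simp add: power2_eq_square mult_left_le)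
  hence "1 / sqrt (1 - w\<^sup>2) \<le> 1 / (1 - w\<^sup>2)" using w2 by (intro divide_left_mono) auto
  hence "1 / sqrt (1 - w\<^sup>2) / 2 \<le> 1 / (1 - w\<^sup>2) / 2" by (rule divide_right_mono) simp
  hence \<delta>: "1/2 / sqrt (1 - w\<^sup>2) \<le> 1 / (2 * (1 - w\<^sup>2))"
    by (simp only: divide_divide_eq_left mult.commute)
  \<comment> \<open>Replacing the square root by its argument makes both claims polynomial over the common
    denominator \<open>D\<close>.\<close>
  define D where "D = 2 * (1 - w\<^sup>2)"
  have D: "D > 0" using w2 by (simp add: D_def)
  have D_factor: "D = 2 * (1 - w) * (1 + w)" by (simp add: D_def algebra_simps power2_eq_square)
  have cancel: "u * u / (2 * u * v) = u / v / 2" "u * u / (2 * v * u) = u / v / 2" if "u \<noteq> 0" for u v :: real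
    using that by auto
  have "1 / D + w = (1 + w * D) / D" using D by (simp add: add_divide_distrib)
  also have "\<dots> \<le> (1 + w)\<^sup>2 / D"
    using D assms by (intro divide_right_mono) (simp_all add: D_def power2_eq_square algebra_simps)
  also have "\<dots> = (1 + w) / (1 - w) / 2"
    unfolding D_factor power2_eq_square using assms by (intro cancel) simp
  finally have "1/2 / sqrt (1 - w\<^sup>2) + w \<le> (1 + w) / (1 - w) / 2"
    using \<delta> unfolding D_def by linarith
  hence "(1/2 / sqrt (1 - w\<^sup>2) + w) * ((1 - w) / (1 + w)) \<le> (1 + w) / (1 - w) / 2 * ((1 - w) / (1 + w))"
    using assms by (intro mult_right_mono) auto
  also have "\<dots> = 1/2" using assms by (simp add: divide_simps)
  finally show "tilted_upper (1/2) 1 w \<le> 1/2" unfolding tilted_upper_def by simp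
  have "w\<^sup>2 * (2 * w) \<le> w\<^sup>2 * 1" using assms by (intro mult_left_mono) auto
  hence num: "1 - w * D \<le> (1 - w)\<^sup>2" by (simp add: D_def power2_eq_square algebra_simps)
  have "1 / D - w = (1 - w * D) / D" using D by (simp add: diff_divide_distrib)
  also have "\<dots> \<le> (1 - w)\<^sup>2 / D"
    using D num by (intro divide_right_mono) auto
  also have "\<dots> = (1 - w) / (1 + w) / 2"
    unfolding D_factor power2_eq_square using assms by (intro cancel) simp
  finally have "1/2 / sqrt (1 - w\<^sup>2) - w \<le> (1 - w) / (1 + w) / 2"
    using \<delta> unfolding D_def by linarith
  hence "(1/2 / sqrt (1 - w\<^sup>2) - w) * ((1 + w) / (1 - w)) \<le> (1 - w) / (1 + w) / 2 * ((1 + w) / (1 - w))"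
    using assms by (intro mult_right_mono) auto
  also have "\<dots> = 1/2" using assms by (simp add: divide_simps)
  finally show "tilted_lower (1/2) 1 w \<le> 1/2" unfolding tilted_lower_def by simp
qed

text \<open>The diagonal blocks move inwards by an amount of order \<open>w\<^sup>2\<close>, and the steepness of the entropy turns
  this into a gain of \<open>M\<close> times that order for any \<open>M\<close>. The value \<open>M = 8\<close> gives \<open>3 w\<^sup>2\<close>, more than
  the \<open>2 w\<^sup>2\<close> that bounds the loss from the off-diagonal block.\<close>

lemma not_local_maximizer_half:
  assumes sign: "\<sigma> = 1 \<or> \<sigma> = - 1"
  shows "\<not> bipodal_local_maximizer (1/2) ((1/2)\<^sup>2 / 4 + 1/4) (1/2 + \<sigma> * (1/2), 1/2 - \<sigma> * (1/2), 1/2, 1/2)"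
proof (rule not_local_maximizer_by_tilting[OF sign])
  define \<theta> :: real where "\<theta> = max 0 (1/2 - exp (- 2 * 8))"
  have \<theta>: "\<theta> < 1/2" unfolding \<theta>_def max_less_iff_conj by simp
  have "eventually (\<lambda>w. \<theta> < tilted_upper (1/2) 1 w) (at_right 0)"
    "eventually (\<lambda>w. \<theta> < tilted_lower (1/2) 1 w) (at_right 0)"
    using \<theta> by (auto intro: order_tendstoD(1)[OF tendsto_tilted(1)] order_tendstoD(1)[OF tendsto_tilted(2)])
  moreover have "eventually (\<lambda>w::real. w \<in> {0<..<1/4}) (at_right 0)"
    by (intro eventually_at_right_real) auto
  ultimately show "eventually (\<lambda>w. \<bar>tilted_upper (1/2) 1 w\<bar> \<le> 1/2 \<and> \<bar>tilted_lower (1/2) 1 w\<bar> \<le> 1/2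
      \<and> (centred_entropy (1/2) + centred_entropy 0) / 2 < tilted_entropy (1/2) 1 w) (at_right 0)"
  proof eventually_elim
    case (elim w)
    define A B c where "A = tilted_upper (1/2) 1 w" and "B = tilted_lower (1/2) 1 w" and "c = (1 + w) / 2"
    define \<kappa> where "\<kappa> = sqrt (1 - w\<^sup>2)"
    have w: "0 < w" "w < 1/4" "\<bar>w\<bar> < 1" using elim by auto
    have AB: "0 \<le> A" "1/2 - exp (- 2 * 8) \<le> A" "A \<le> 1/2" "0 \<le> B" "1/2 - exp (- 2 * 8) \<le> B" "B \<le> 1/2"
      using elim tilted_half_le[of w] w unfolding A_def B_def \<theta>_def by auto
    have w2: "0 < w\<^sup>2" "w\<^sup>2 < 1" using w by (auto simp: abs_square_less_1)
    have \<kappa>: "0 < \<kappa>" "\<kappa> \<le> 1" using w2 by (auto simp: \<kappa>_def)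
    note tilt = tilted_upper_eq[OF w(3) c_def, of "1/2" 1, folded A_def]
      tilted_lower_eq[OF w(3) c_def, of "1/2" 1, folded B_def]
    have "c\<^sup>2 * (A - 1/2) + (1 - c)\<^sup>2 * (B - 1/2) = - (1/2 * w\<^sup>2 / 2) * (1 + 1 / (1 + \<kappa>))"
      using linear_shift[OF w(3) c_def refl tilt] by (simp only: \<kappa>_def)
    hence "c\<^sup>2 * (8 * (1/2 - A)) + (1 - c)\<^sup>2 * (8 * (1/2 - B)) = 2 * w\<^sup>2 * (1 + 1 / (1 + \<kappa>))"
      by (simp only: right_diff_distrib)
    also have "\<dots> \<ge> 2 * w\<^sup>2 * (1 + 1/2)"
      using \<kappa> by (intro mult_left_mono add_left_mono divide_left_mono) auto
    also have "c\<^sup>2 * (8 * (1/2 - A)) + (1 - c)\<^sup>2 * (8 * (1/2 - B))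
        \<le> c\<^sup>2 * centred_entropy A + (1 - c)\<^sup>2 * centred_entropy B"
      using AB by (intro add_mono mult_left_mono centred_entropy_steep_at_half) auto
    finally have gain: "3 * w\<^sup>2 \<le> c\<^sup>2 * centred_entropy A + (1 - c)\<^sup>2 * centred_entropy B" by simp
    have quarter: "1 - 4 * (1/4)\<^sup>2 = (3/4::real)" by (simp add: power2_eq_square)
    have "centred_entropy 0 - w\<^sup>2 / (3/4) \<le> centred_entropy w"
      using centred_entropy_ge_quadratic[of 0 "1/4" w] w unfolding quarter by simp
    hence "(1 - w\<^sup>2) / 2 * (centred_entropy 0 - w\<^sup>2 / (3/4)) \<le> (1 - w\<^sup>2) / 2 * centred_entropy w"
      using w2 by (intro mult_left_mono) auto
    moreover have "(1 - w\<^sup>2) / 2 * (centred_entropy 0 - w\<^sup>2 / (3/4))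
        = centred_entropy 0 / 2 - w\<^sup>2 * (centred_entropy 0 / 2 + 2/3) + 2/3 * (w\<^sup>2 * w\<^sup>2)"
      by (simp add: field_simps)
    moreover have "w\<^sup>2 * (centred_entropy 0 / 2 + 2/3) \<le> w\<^sup>2 * 2"
    proof (rule mult_left_mono)
      have "centred_entropy 0 = - ln (1/2) / 2"
        by (simp add: centred_entropy_def entropy_density_def)
      moreover have "- ln (1/2::real) \<le> 1" using ln_le_minus_one[of 2] by (simp add: ln_div)
      ultimately show "centred_entropy 0 / 2 + 2/3 \<le> 2" by simp
    qed simp
    moreover have "0 \<le> w\<^sup>2 * w\<^sup>2" by simp
    ultimately have "centred_entropy 0 / 2 < c\<^sup>2 * centred_entropy A + (1 - c)\<^sup>2 * centred_entropy B
        + (1 - w\<^sup>2) / 2 * centred_entropy w"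
      using gain w2(1) by linarith
    also have "1 - c = (1 - w) / 2" unfolding c_def by (simp add: field_simps)
    finally have "(centred_entropy (1/2) + centred_entropy 0) / 2 < tilted_entropy (1/2) 1 w"
      unfolding centred_entropy_half tilted_entropy_def A_def B_def c_def by simp
    thus ?case using AB unfolding A_def B_def by auto
  qed
qed

section \<open>The phase transition\<close>

text \<open>Both symmetric points of a given density are covered, through the sign and the absolute value of
  their deviation.\<close>

lemma symmetric_not_local_maximizer:
  assumes t: "0 < t" and params: "(1/2 + \<alpha>, 1/2 - \<alpha>, 1/2, 1/2) \<in> bipodal_params (1/2) (t + 1/4)"
    and pos: "16 * t < 1 \<Longrightarrow> 0 < tilt_curvature (sqrt (16 * t) / 2)"
  shows "\<not> bipodal_local_maximizer (1/2) (t + 1/4) (1/2 + \<alpha>, 1/2 - \<alpha>, 1/2, 1/2)"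
proof -
  have \<alpha>: "\<bar>\<alpha>\<bar> \<le> 1/2" "t = \<bar>\<alpha>\<bar>\<^sup>2 / 4"
    using params unfolding symmetric_bipodal_params_iff by simp_all
  have abs_pos: "0 < \<bar>\<alpha>\<bar>" using t \<alpha>(2) by auto
  have "16 * t = (2 * \<bar>\<alpha>\<bar>)\<^sup>2" using \<alpha>(2) by (simp add: power_mult_distrib)
  hence "sqrt (16 * t) = \<bar>2 * \<bar>\<alpha>\<bar>\<bar>" by (simp only: real_sqrt_abs)
  hence root: "sqrt (16 * t) / 2 = \<bar>\<alpha>\<bar>" by simp
  have sign: "sgn \<alpha> = 1 \<or> sgn \<alpha> = - 1" "\<alpha> = sgn \<alpha> * \<bar>\<alpha>\<bar>"
    using abs_pos by (auto simp: sgn_if)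
  have "\<not> bipodal_local_maximizer (1/2) (\<bar>\<alpha>\<bar>\<^sup>2 / 4 + 1/4)
      (1/2 + sgn \<alpha> * \<bar>\<alpha>\<bar>, 1/2 - sgn \<alpha> * \<bar>\<alpha>\<bar>, 1/2, 1/2)"
  proof (cases "\<bar>\<alpha>\<bar> = 1/2")
    case True
    show ?thesis unfolding True by (rule not_local_maximizer_half[OF sign(1)])
  next
    case False
    hence less: "\<bar>\<alpha>\<bar> < 1/2" using \<alpha> by simp
    hence "\<bar>\<alpha>\<bar>\<^sup>2 < (1/2)\<^sup>2" by (intro power_strict_mono) auto
    hence "16 * t < 1" using \<alpha>(2) by (simp add: power2_eq_square)
    hence "0 < tilt_curvature \<bar>\<alpha>\<bar>" using pos unfolding root by blast
    thus ?thesis by (rule not_local_maximizer_if_curvature_pos[OF sign(1) abs_pos less])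
  qed
  thus ?thesis unfolding \<alpha>(2)[symmetric] sign(2)[symmetric] .
qed

theorem theorem3:
  shows "\<exists>t_star::real. \<bar>t_star - 0.03727637\<bar> \<le> 0.000000005 \<and>
    (\<forall>tt::real. 0 \<le> tt \<and> tt < t_star \<longrightarrow>
       (\<exists>a b c d. b = 1 - a \<and> c = 1/2 \<and> d = 1/2 \<and>
          bipodal_local_maximizer (1/2) (tt + 1/4) (a, b, c, d))) \<and>
    (\<forall>tt::real. t_star < tt \<and> tt \<le> 0.0625 \<longrightarrow>
       (\<exists>a b c d. b = 1 - a \<and> c = 1/2 \<and> d = 1/2 \<and>
          (a, b, c, d) \<in> bipodal_params (1/2) (tt + 1/4)) \<and>
       (\<forall>a b c d. b = 1 - a \<and> c = 1/2 \<and> d = 1/2 \<and>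
          (a, b, c, d) \<in> bipodal_params (1/2) (tt + 1/4) \<longrightarrow>
          \<not> bipodal_local_maximizer (1/2) (tt + 1/4) (a, b, c, d))) \<and>
    (\<forall>tt::real. 0.0625 < tt \<longrightarrow>
       \<not> (\<exists>a b c d. b = 1 - a \<and> c = 1/2 \<and> d = 1/2 \<and>
          (a, b, c, d) \<in> bipodal_params (1/2) (tt + 1/4)))"
proof -
  obtain z\<^sub>0 :: real where z\<^sub>0: "7455273/12500000 \<le> z\<^sub>0" "z\<^sub>0 \<le> 298211/500000"
    and neg: "\<And>z. 0 < z \<Longrightarrow> z < z\<^sub>0 \<Longrightarrow> tilt_curvature (sqrt z / 2) < 0"
    and pos: "\<And>z. z\<^sub>0 < z \<Longrightarrow> z < 1 \<Longrightarrow> 0 < tilt_curvature (sqrt z / 2)"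
    using tilt_curvature_root by blast
  have params: "(1/2 + sqrt (16 * t) / 2, 1/2 - sqrt (16 * t) / 2, 1/2, 1/2) \<in> bipodal_params (1/2) (t + 1/4)"
    if "0 \<le> t" "16 * t \<le> 1" for t :: real
    unfolding symmetric_bipodal_params_iff using that by (simp add: power_divide)
  have centred: "(a, b, c, d) = (1/2 + (a - 1/2), 1/2 - (a - 1/2), 1/2, 1/2)"
    if "b = 1 - a" "c = 1/2" "d = 1/2" for a b c d :: real
    using that by simp
  show ?thesis
  proof (rule exI[of _ "z\<^sub>0 / 16"], (intro conjI allI impI; (elim conjE)?))
    show "\<bar>z\<^sub>0 / 16 - 0.03727637\<bar> \<le> 0.000000005"
      using z\<^sub>0 by (intro abs_leI) simp_all
  next
    fix t :: real
    assume t: "0 \<le> t" "t < z\<^sub>0 / 16"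
    define \<alpha> where "\<alpha> = sqrt (16 * t) / 2"
    have "bipodal_local_maximizer (1/2) (t + 1/4) (1/2 + \<alpha>, 1/2 - \<alpha>, 1/2, 1/2)"
    proof (cases "t = 0")
      case True
      thus ?thesis using constant_local_maximizer by (simp add: \<alpha>_def)
    next
      case False
      hence z: "0 < 16 * t" "16 * t < z\<^sub>0" "16 * t < 1" using t z\<^sub>0 by auto
      hence "sqrt (16 * t) < 1" by simp
      hence "0 < \<alpha>" "\<alpha> < 1/2" using z(1) unfolding \<alpha>_def by auto
      moreover have "tilt_curvature \<alpha> < 0" unfolding \<alpha>_def by (rule neg[OF z(1,2)])
      moreover have "t = \<alpha>\<^sup>2 / 4" using z(1) by (simp add: \<alpha>_def power_divide)
      ultimately show ?thesis using local_maximizer_if_curvature_neg by blast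
    qed
    thus "\<exists>a b c d. b = 1 - a \<and> c = 1/2 \<and> d = 1/2 \<and>
        bipodal_local_maximizer (1/2) (t + 1/4) (a, b, c, d)"
      by (intro exI[of _ "1/2 + \<alpha>"] exI[of _ "1/2 - \<alpha>"] exI[of _ "1/2"] conjI) simp_all
  next
    fix t :: real
    assume t: "z\<^sub>0 / 16 < t" "t \<le> 0.0625"
    have "0 \<le> t" "16 * t \<le> 1" using t z\<^sub>0 by auto
    from params[OF this] show "\<exists>a b c d. b = 1 - a \<and> c = 1/2 \<and> d = 1/2 \<and>
        (a, b, c, d) \<in> bipodal_params (1/2) (t + 1/4)"
      by (intro exI[of _ "1/2 + sqrt (16 * t) / 2"] exI[of _ "1/2 - sqrt (16 * t) / 2"] exI[of _ "1/2"] conjI)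
        simp_all
  next
    fix t a b c d :: real
    assume t: "z\<^sub>0 / 16 < t" "t \<le> 0.0625" and abcd: "b = 1 - a" "c = 1/2" "d = 1/2"
      and mem: "(a, b, c, d) \<in> bipodal_params (1/2) (t + 1/4)"
    have "0 < t" "z\<^sub>0 < 16 * t" using t z\<^sub>0 by auto
    thus "\<not> bipodal_local_maximizer (1/2) (t + 1/4) (a, b, c, d)"
      using mem pos unfolding centred[OF abcd] by (intro symmetric_not_local_maximizer) auto
  next
    fix t :: real
    assume t: "0.0625 < t"
    show "\<not> (\<exists>a b c d. b = 1 - a \<and> c = 1/2 \<and> d = 1/2 \<and>
        (a, b, c, d) \<in> bipodal_params (1/2) (t + 1/4))"
    proof (intro notI, elim exE conjE)
      fix a b c d :: real
      assume abcd: "b = 1 - a" "c = 1/2" "d = 1/2"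
        and mem: "(a, b, c, d) \<in> bipodal_params (1/2) (t + 1/4)"
      have "\<bar>a - 1/2\<bar> \<le> 1/2" "t = (a - 1/2)\<^sup>2 / 4"
        using mem unfolding centred[OF abcd] symmetric_bipodal_params_iff by simp_all
      hence "t \<le> (1/2)\<^sup>2 / 4" using power_mono[of "\<bar>a - 1/2\<bar>" "1/2" 2] by simp
      thus False using t by (simp add: power2_eq_square)
    qed
  qed
qed

end
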